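(* Let $\alpha,\beta,\gamma\in\mathbb{R}$ with $\gamma\neq 0$, and let $(G_2,g,J)$ be the connected three-dimensional unimodular Lie group with left-invariant Lorentzian metric $g$ whose Lie algebra has a pseudo-orthonormal basis $\{e_1,e_2,e_3\}$, $e_3$ timelike, with $$[e_1,e_2]=\gamma e_2-\beta e_3,\quad [e_1,e_3]=-\beta e_2-\gamma e_3,\quad [e_2,e_3]=\alpha e_1,$$ and with the product structure $J$ given by $Je_1=e_1$, $Je_2=e_2$, $Je_3=-e_3$. Put $$A=\gamma\big(2\gamma^2+\beta^2+\tfrac12\alpha\beta\big),\quad B=\gamma^2\big(\tfrac32\alpha-\beta\big)+\alpha\beta(\alpha-\beta),\quad C=\gamma^2\big(\beta+\tfrac32\alpha\big)+\alpha^2\beta,\quad D=\beta\gamma\big(\tfrac12\alpha-\beta\big).$$ Then $(G_2,g,J)$ admits left-invariant Ricci collineations associated to the canonical connection $\nabla^0$ if and only if one of the following holds, and in each case the space $\mathbb{V}_{\mathbb{RC}}$ of these collineations is as indicated: (1) $\alpha=\beta=0$, with $\mathbb{V}_{\mathbb{RC}}=\langle e_3\rangle$ (i.e. $\lambda_1=\lambda_2=0$); (2) $\alpha\neq0$, $\beta\neq0$, $\begin{vmatrix}A&B\\ C&D\end{vmatrix}=0$, with $\mathbb{V}_{\mathbb{RC}}=\langle e_2-\frac{C}{D}e_3\rangle$.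
   Context: Pseudo-orthonormal with $e_3$ timelike means $g(e_1,e_1)=g(e_2,e_2)=1$, $g(e_3,e_3)=-1$, $g(e_i,e_j)=0$ for $i\ne j$. $J$ is extended left-invariantly to a $(1,1)$-tensor with $J^2=\mathrm{id}$. Let $\nabla$ be the Levi-Civita connection of $g$. The canonical connection is $$\nabla^0_XY=\nabla_XY-\tfrac12(\nabla_XJ)JY,$$ with curvature $R^0(X,Y)Z=\nabla^0_X\nabla^0_YZ-\nabla^0_Y\nabla^0_XZ-\nabla^0_{[X,Y]}Z$. Its Ricci tensor is $$\mathrm{Ric}^0(X,Y)=-g(R^0(X,e_1)Y,e_1)-g(R^0(X,e_2)Y,e_2)+g(R^0(X,e_3)Y,e_3),$$ and its symmetrization is $\widetilde{\mathrm{Ric}}^0(X,Y)=\frac12\big(\mathrm{Ric}^0(X,Y)+\mathrm{Ric}^0(Y,X)\big)$. For a left-invariant vector field $\xi=\lambda_1e_1+\lambda_2e_2+\lambda_3e_3$ ($\lambda_i\in\mathbb{R}$), $$(L_\xi\widetilde{\mathrm{Ric}}^0)(X,Y)=\xi\big(\widetilde{\mathrm{Ric}}^0(X,Y)\big)-\widetilde{\mathrm{Ric}}^0([\xi,X],Y)-\widetilde{\mathrm{Ric}}^0(X,[\xi,Y]).$$ A left-invariant Ricci collineation associated to $\nabla^0$ is a left-invariant $\xi$ with $L_\xi\widetilde{\mathrm{Ric}}^0=0$; $\mathbb{V}_{\mathbb{RC}}$ denotes the real vector space of all of them, and $\langle\cdot\rangle$ denotes linear span. The group admits left-invariant Ricci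 collineations if there is a nonzero such $\xi$. *)

theory Defs
  imports "HOL-Analysis.Analysis" "HOL-Library.Function_Algebras"
begin

section \<open>Smooth manifolds and Lie groups\<close>

text \<open>
  \<open>C_k_on k S f\<close>, meant for open \<open>S\<close> and finite-dimensional domain: all iterated directional
  derivatives of \<open>f\<close> of order at most \<open>k\<close> exist and are continuous on \<open>S\<close>.
\<close>

fun C_k_on :: "nat \<Rightarrow> 'a::real_normed_vector set \<Rightarrow> ('a \<Rightarrow> 'b::real_normed_vector) \<Rightarrow> bool" where
  "C_k_on 0 S f \<longleftrightarrow> continuous_on S f"
| "C_k_on (Suc k) S f \<longleftrightarrow>
     (\<forall>x\<in>S. f differentiable (at x)) \<and>
     (\<forall>v. C_k_on k S (\<lambda>x. frechet_derivative f (at x) v))"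

definition smooth_on :: "'a::real_normed_vector set \<Rightarrow> ('a \<Rightarrow> 'b::real_normed_vector) \<Rightarrow> bool" where
  "smooth_on S f \<longleftrightarrow> (\<forall>k. C_k_on k S f)"

text \<open>
  A manifold is the whole type \<open>'m\<close> (Hausdorff and second countable by its type class) with an
  atlas of charts \<open>(U, \<phi>)\<close> into \<open>'e\<close>. The atlas need not be maximal; \<open>\<phi>\<close> is irrelevant outside \<open>U\<close>.
\<close>

type_synonym ('m, 'e) atlas = "('m set \<times> ('m \<Rightarrow> 'e)) set"

definition smooth_atlas ::
  "('m::{t2_space,second_countable_topology}, 'e::euclidean_space) atlas \<Rightarrow> bool" where
  "smooth_atlas A \<longleftrightarrow>
     (\<forall>(U, \<phi>)\<in>A. open U \<and> open (\<phi> ` U) \<and> homeomorphism U (\<phi> ` U) \<phi> (inv_into U \<phi>)) \<and>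
     (\<Union>(U, \<phi>)\<in>A. U) = UNIV \<and>
     (\<forall>(U, \<phi>)\<in>A. \<forall>(V, \<psi>)\<in>A. smooth_on (\<phi> ` (U \<inter> V)) (\<psi> \<circ> inv_into U \<phi>))"

definition smooth_fun :: "('m, 'e::euclidean_space) atlas \<Rightarrow> ('m \<Rightarrow> real) \<Rightarrow> bool" where
  "smooth_fun A f \<longleftrightarrow> (\<forall>(U, \<phi>)\<in>A. smooth_on (\<phi> ` U) (f \<circ> inv_into U \<phi>))"

text \<open>
  The group is written multiplicatively with operation \<open>m\<close>, unit \<open>u\<close> and inversion \<open>i\<close>;
  \<open>group\<close> is the locale of theory \<open>Groups\<close>. Smoothness of \<open>m\<close> and \<open>i\<close> is smoothness of their
  local representatives.
\<close>

definition lie_group ::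
  "('m::{t2_space,second_countable_topology} \<Rightarrow> 'm \<Rightarrow> 'm) \<Rightarrow> 'm \<Rightarrow> ('m \<Rightarrow> 'm) \<Rightarrow>
   ('m, 'e::euclidean_space) atlas \<Rightarrow> bool" where
  "lie_group m u i A \<longleftrightarrow>
     group m u i \<and> smooth_atlas A \<and>
     continuous_on UNIV (\<lambda>(p, q). m p q) \<and> continuous_on UNIV i \<and>
     (\<forall>(U, \<phi>)\<in>A. \<forall>(V, \<psi>)\<in>A. \<forall>(W, \<theta>)\<in>A.
        smooth_on {(x, y) \<in> \<phi> ` U \<times> \<psi> ` V. m (inv_into U \<phi> x) (inv_into V \<psi> y) \<in> W}
          (\<lambda>(x, y). \<theta> (m (inv_into U \<phi> x) (inv_into V \<psi> y)))) \<and>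
     (\<forall>(U, \<phi>)\<in>A. \<forall>(V, \<psi>)\<in>A.
        smooth_on {x \<in> \<phi> ` U. i (inv_into U \<phi> x) \<in> V} (\<lambda>x. \<psi> (i (inv_into U \<phi> x))))"


section \<open>Vector fields\<close>

text \<open>
  A tangent vector at \<open>p\<close> is its action on smooth functions: in every chart around \<open>p\<close> it is the
  directional derivative along some coordinate vector \<open>a\<close>. Requiring the value 0 on non-smooth
  functions makes two tangent vectors equal as soon as they agree on all smooth functions.
  Sums and differences of tangent vectors and of vector fields are the pointwise ones.
\<close>

type_synonym 'm tangent = "('m \<Rightarrow> real) \<Rightarrow> real"
type_synonym 'm vfield = "'m \<Rightarrow> 'm tangent"

definition tangent_space :: "('m, 'e::euclidean_space) atlas \<Rightarrow> 'm \<Rightarrow> 'm tangent set" where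
  "tangent_space A p =
     {v. (\<forall>(U, \<phi>)\<in>A. p \<in> U \<longrightarrow>
            (\<exists>a. \<forall>f. smooth_fun A f \<longrightarrow>
               v f = frechet_derivative (f \<circ> inv_into U \<phi>) (at (\<phi> p)) a)) \<and>
         (\<forall>f. \<not> smooth_fun A f \<longrightarrow> v f = 0)}"

definition scale_tangent :: "real \<Rightarrow> 'm tangent \<Rightarrow> 'm tangent" where
  "scale_tangent c v = (\<lambda>f. c * v f)"

definition app :: "'m vfield \<Rightarrow> ('m \<Rightarrow> real) \<Rightarrow> 'm \<Rightarrow> real" where
  "app X f = (\<lambda>p. X p f)"

definition vector_fields :: "('m, 'e::euclidean_space) atlas \<Rightarrow> 'm vfield set" where
  "vector_fields A =
     {X. (\<forall>p. X p \<in> tangent_space A p) \<and> (\<forall>f. smooth_fun A f \<longrightarrow> smooth_fun A (app X f))}"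

definition fscale :: "('m \<Rightarrow> real) \<Rightarrow> 'm vfield \<Rightarrow> 'm vfield" where
  "fscale h X = (\<lambda>p. scale_tangent (h p) (X p))"

definition rscale :: "real \<Rightarrow> 'm vfield \<Rightarrow> 'm vfield" where
  "rscale c X = fscale (\<lambda>_. c) X"

definition bracket :: "'m vfield \<Rightarrow> 'm vfield \<Rightarrow> 'm vfield" where
  "bracket X Y = (\<lambda>p f. X p (app Y f) - Y p (app X f))"


section \<open>The Lie algebra of left-invariant vector fields\<close>

text \<open>
  The differential of the left translation by \<open>a\<close>; it maps the tangent space at \<open>p\<close> to the
  one at \<open>m a p\<close>.
\<close>

definition d_left :: "('m \<Rightarrow> 'm \<Rightarrow> 'm) \<Rightarrow> 'm \<Rightarrow> 'm tangent \<Rightarrow> 'm tangent" where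
  "d_left m a v = (\<lambda>f. v (\<lambda>q. f (m a q)))"

definition lie_algebra ::
  "('m \<Rightarrow> 'm \<Rightarrow> 'm) \<Rightarrow> ('m, 'e::euclidean_space) atlas \<Rightarrow> 'm vfield set" where
  "lie_algebra m A = {X \<in> vector_fields A. \<forall>a p. X (m a p) = d_left m a (X p)}"

text \<open>
  Bases are indexed by the three-element type \<open>3\<close>, in which the numeral \<open>3\<close> denotes \<open>0\<close>, so that
  \<open>1\<close>, \<open>2\<close>, \<open>3\<close> are its three distinct elements.
\<close>

definition lie_basis ::
  "('m \<Rightarrow> 'm \<Rightarrow> 'm) \<Rightarrow> ('m, 'e::euclidean_space) atlas \<Rightarrow> (3 \<Rightarrow> 'm vfield) \<Rightarrow> bool" where
  "lie_basis m A e \<longleftrightarrow>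
     bij_betw (\<lambda>c::real^3. \<Sum>k\<in>UNIV. rscale (c $ k) (e k)) UNIV (lie_algebra m A)"

text \<open>
  A connected Lie group is unimodular iff every \<open>ad X\<close> has trace 0; column \<open>j\<close> of \<open>M\<close> holds the
  coordinates of \<open>ad X (b j)\<close>.
\<close>

definition unimodular :: "('m \<Rightarrow> 'm \<Rightarrow> 'm) \<Rightarrow> ('m, 'e::euclidean_space) atlas \<Rightarrow> bool" where
  "unimodular m A \<longleftrightarrow>
     (\<forall>b X. \<forall>M::real^3^3.
        lie_basis m A b \<and> X \<in> lie_algebra m A \<and>
        (\<forall>j. bracket X (b j) = (\<Sum>k\<in>UNIV. rscale (M $ k $ j) (b k))) \<longrightarrow>
        trace M = 0)"


section \<open>Lorentzian metrics, product structures and connections\<close>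

type_synonym 'm metric = "'m \<Rightarrow> 'm tangent \<Rightarrow> 'm tangent \<Rightarrow> real"
type_synonym 'm endo_field = "'m \<Rightarrow> 'm tangent \<Rightarrow> 'm tangent"
type_synonym 'm connection = "'m vfield \<Rightarrow> 'm vfield \<Rightarrow> 'm vfield"

definition inner_fun :: "'m metric \<Rightarrow> 'm vfield \<Rightarrow> 'm vfield \<Rightarrow> 'm \<Rightarrow> real" where
  "inner_fun g X Y = (\<lambda>p. g p (X p) (Y p))"

definition pseudo_orthonormal :: "('v \<Rightarrow> 'v \<Rightarrow> real) \<Rightarrow> (3 \<Rightarrow> 'v) \<Rightarrow> bool" where
  "pseudo_orthonormal h b \<longleftrightarrow>
     h (b 1) (b 1) = 1 \<and> h (b 2) (b 2) = 1 \<and> h (b 3) (b 3) = -1 \<and>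
     (\<forall>j k. j \<noteq> k \<longrightarrow> h (b j) (b k) = 0)"

definition lorentzian_metric :: "('m, real^3) atlas \<Rightarrow> 'm metric \<Rightarrow> bool" where
  "lorentzian_metric A g \<longleftrightarrow>
     (\<forall>p. \<forall>v\<in>tangent_space A p. \<forall>w\<in>tangent_space A p.
        g p v w = g p w v \<and>
        (\<forall>c. g p (scale_tangent c v) w = c * g p v w) \<and>
        (\<forall>v'\<in>tangent_space A p. g p (v + v') w = g p v w + g p v' w)) \<and>
     (\<forall>p. \<exists>b. pseudo_orthonormal (g p) b \<and>
        bij_betw (\<lambda>c::real^3. \<Sum>k\<in>UNIV. scale_tangent (c $ k) (b k)) UNIV (tangent_space A p)) \<and>
     (\<forall>X\<in>vector_fields A. \<forall>Y\<in>vector_fields A. smooth_fun A (inner_fun g X Y))"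

definition left_invariant_metric ::
  "('m \<Rightarrow> 'm \<Rightarrow> 'm) \<Rightarrow> ('m, 'e::euclidean_space) atlas \<Rightarrow> 'm metric \<Rightarrow> bool" where
  "left_invariant_metric m A g \<longleftrightarrow>
     (\<forall>a p. \<forall>v\<in>tangent_space A p. \<forall>w\<in>tangent_space A p.
        g (m a p) (d_left m a v) (d_left m a w) = g p v w)"

definition endo_app :: "'m endo_field \<Rightarrow> 'm vfield \<Rightarrow> 'm vfield" where
  "endo_app J X = (\<lambda>p. J p (X p))"

definition tensor_1_1 :: "('m, 'e::euclidean_space) atlas \<Rightarrow> 'm endo_field \<Rightarrow> bool" where
  "tensor_1_1 A J \<longleftrightarrow>
     (\<forall>p. \<forall>v\<in>tangent_space A p.
        J p v \<in> tangent_space A p \<and>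
        (\<forall>c. J p (scale_tangent c v) = scale_tangent c (J p v)) \<and>
        (\<forall>w\<in>tangent_space A p. J p (v + w) = J p v + J p w)) \<and>
     (\<forall>X\<in>vector_fields A. endo_app J X \<in> vector_fields A)"

definition left_invariant_product_structure ::
  "('m \<Rightarrow> 'm \<Rightarrow> 'm) \<Rightarrow> ('m, 'e::euclidean_space) atlas \<Rightarrow> 'm endo_field \<Rightarrow> bool" where
  "left_invariant_product_structure m A J \<longleftrightarrow>
     tensor_1_1 A J \<and>
     (\<forall>p. \<forall>v\<in>tangent_space A p. J p (J p v) = v) \<and>
     (\<forall>a p. \<forall>v\<in>tangent_space A p. J (m a p) (d_left m a v) = d_left m a (J p v))"

definition affine_connection :: "('m, 'e::euclidean_space) atlas \<Rightarrow> 'm connection \<Rightarrow> bool" where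
  "affine_connection A D \<longleftrightarrow>
     (\<forall>X\<in>vector_fields A. \<forall>Y\<in>vector_fields A.
        D X Y \<in> vector_fields A \<and>
        (\<forall>Z\<in>vector_fields A. D (X + Z) Y = D X Y + D Z Y \<and> D X (Y + Z) = D X Y + D X Z) \<and>
        (\<forall>f. smooth_fun A f \<longrightarrow>
           D (fscale f X) Y = fscale f (D X Y) \<and>
           D X (fscale f Y) = fscale (app X f) Y + fscale f (D X Y)))"

definition levi_civita ::
  "('m, 'e::euclidean_space) atlas \<Rightarrow> 'm metric \<Rightarrow> 'm connection \<Rightarrow> bool" where
  "levi_civita A g D \<longleftrightarrow>
     affine_connection A D \<and>
     (\<forall>X\<in>vector_fields A. \<forall>Y\<in>vector_fields A. D X Y - D Y X = bracket X Y) \<and>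
     (\<forall>X\<in>vector_fields A. \<forall>Y\<in>vector_fields A. \<forall>Z\<in>vector_fields A.
        app X (inner_fun g Y Z) = inner_fun g (D X Y) Z + inner_fun g Y (D X Z))"


section \<open>The canonical connection and its Ricci collineations\<close>

definition cov_endo :: "'m connection \<Rightarrow> 'm endo_field \<Rightarrow> 'm vfield \<Rightarrow> 'm vfield \<Rightarrow> 'm vfield" where
  "cov_endo D J X Y = D X (endo_app J Y) - endo_app J (D X Y)"

definition canonical_connection :: "'m connection \<Rightarrow> 'm endo_field \<Rightarrow> 'm connection" where
  "canonical_connection D J X Y = D X Y - rscale (1/2) (cov_endo D J X (endo_app J Y))"

definition curvature :: "'m connection \<Rightarrow> 'm vfield \<Rightarrow> 'm vfield \<Rightarrow> 'm vfield \<Rightarrow> 'm vfield" where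
  "curvature D X Y Z = D X (D Y Z) - D Y (D X Z) - D (bracket X Y) Z"

definition ricci ::
  "'m metric \<Rightarrow> (3 \<Rightarrow> 'm vfield) \<Rightarrow> 'm connection \<Rightarrow> 'm vfield \<Rightarrow> 'm vfield \<Rightarrow> 'm \<Rightarrow> real" where
  "ricci g e D X Y =
     - inner_fun g (curvature D X (e 1) Y) (e 1)
     - inner_fun g (curvature D X (e 2) Y) (e 2)
     + inner_fun g (curvature D X (e 3) Y) (e 3)"

definition ricci_sym ::
  "'m metric \<Rightarrow> (3 \<Rightarrow> 'm vfield) \<Rightarrow> 'm connection \<Rightarrow> 'm vfield \<Rightarrow> 'm vfield \<Rightarrow> 'm \<Rightarrow> real" where
  "ricci_sym g e D X Y = (\<lambda>p. 1/2 * (ricci g e D X Y p + ricci g e D Y X p))"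

definition lie_derivative ::
  "'m vfield \<Rightarrow> ('m vfield \<Rightarrow> 'm vfield \<Rightarrow> 'm \<Rightarrow> real) \<Rightarrow> 'm vfield \<Rightarrow> 'm vfield \<Rightarrow> 'm \<Rightarrow> real" where
  "lie_derivative \<xi> T X Y = app \<xi> (T X Y) - T (bracket \<xi> X) Y - T X (bracket \<xi> Y)"

definition ricci_collineations ::
  "('m \<Rightarrow> 'm \<Rightarrow> 'm) \<Rightarrow> ('m, 'e::euclidean_space) atlas \<Rightarrow> 'm metric \<Rightarrow> (3 \<Rightarrow> 'm vfield) \<Rightarrow>
   'm connection \<Rightarrow> 'm vfield set" where
  "ricci_collineations m A g e D =
     {\<xi> \<in> lie_algebra m A.
        \<forall>X\<in>vector_fields A. \<forall>Y\<in>vector_fields A. lie_derivative \<xi> (ricci_sym g e D) X Y = 0}"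

definition real_span :: "'m vfield set \<Rightarrow> 'm vfield set" where
  "real_span = module.span rscale"

end

theory Submission
  imports Defs
begin

text \<open>
  The symmetrized Ricci form is tensorial, hence so is its Lie derivative along a fixed field, and
  \<open>L\<^sub>\<xi> Ric = 0\<close> need only be tested on the frame \<open>e\<close>. There the Koszul formula gives \<open>\<nabla>\<close>, and
  \<open>\<nabla>\<^sup>0\<^sub>X Y = (\<nabla>\<^sub>X Y + J \<nabla>\<^sub>X (J Y)) / 2\<close> kills \<open>e 3\<close> and acts on the span of \<open>e 1\<close>, \<open>e 2\<close> by rotations.
  For \<open>\<xi> = l1 e 1 + l2 e 2 + l3 e 3\<close> the resulting equations force \<open>l1 = 0\<close> and otherwise amount to
  \<open>A l2 + B l3 = 0 = C l2 + D l3\<close>.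
\<close>

section \<open>Smooth functions and vector fields\<close>

text \<open>Collineations are tested against all vector fields, so the reduction to frame fields
  needs both linearity over smooth functions and the fact that the orthonormal family
  \<open>e\<close> spans every tangent space; the latter is a dimension argument at each point. On
  the frame the symmetrized Ricci form has only two independent constants, r = Ric(e1,e1) =
  Ric(e2,e2) and s = Ric(e2,e3), and all other components vanish. Because of these zeros, the
  components (1,2) and (1,3) of the Lie derivative involve only l2 and l3, while (2,2), (2,3) and
  (3,3) involve only l1. This is why a homogeneous 2 x 2 system is left over, solvable nontrivially
  exactly when AD - BC = 0. Positivity of \<gamma>^2 + \<beta>^2 then enters three times: it
  excludes l1 \<noteq> 0, it keeps the determinant nonzero for \<alpha> = 0 \<noteq> \<beta>, and it
  gives D \<noteq> 0 when the determinant vanishes with \<alpha>, \<beta> \<noteq> 0, so that the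
  quotient C/D is meaningful.\<close>

lemma frechet_derivative_eq_on_open:
  assumes "open S" "x \<in> S" "\<And>y. y \<in> S \<Longrightarrow> f y = h y" "f differentiable (at x)"
  shows "h differentiable (at x)" "frechet_derivative h (at x) = frechet_derivative f (at x)"
proof -
  have "(f has_derivative frechet_derivative f (at x)) (at x)"
    using assms(4) frechet_derivative_works by blast
  then have *: "(h has_derivative frechet_derivative f (at x)) (at x)"
    using assms(1-3) by (rule has_derivative_transform_within_open)
  then show "h differentiable (at x)"
    by (auto simp: differentiable_def)
  from * show "frechet_derivative h (at x) = frechet_derivative f (at x)"
    by (metis frechet_derivative_at)
qed

text \<open>\<open>frechet_derivative\<close> is a total operator, and the sum and product rules for
  it hold only at points of differentiability. In the inductions on k below, a derivative can
  therefore be replaced by its formula on S only, and openness of S makes that enough.\<close>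

lemma C_k_on_cong:
  assumes "open S" "\<And>x. x \<in> S \<Longrightarrow> f x = h x" "C_k_on k S f"
  shows "C_k_on k S h"
  using assms(2,3)
proof (induction k arbitrary: f h)
  case 0
  then show ?case by (simp cong: continuous_on_cong)
next
  case (Suc k)
  then have diff: "f differentiable (at x)" if "x \<in> S" for x
    using that by simp
  have "C_k_on k S (\<lambda>x. frechet_derivative h (at x) v)" for v
  proof (rule Suc.IH)
    show "C_k_on k S (\<lambda>x. frechet_derivative f (at x) v)"
      using Suc.prems(2) by simp
    show "frechet_derivative f (at x) v = frechet_derivative h (at x) v" if "x \<in> S" for x
      using frechet_derivative_eq_on_open(2)[OF assms(1) that Suc.prems(1) diff] that by simp
  qed
  moreover have "h differentiable (at x)" if "x \<in> S" for x
    using frechet_derivative_eq_on_open(1)[OF assms(1) that Suc.prems(1) diff] that by simp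
  ultimately show ?case by simp
qed

lemma C_k_on_SucD:
  assumes "C_k_on (Suc k) S f"
  shows "C_k_on k S f"
  using assms
proof (induction k arbitrary: f)
  case 0
  then have "f differentiable_on S"
    unfolding differentiable_on_def by (auto intro: differentiable_at_withinI)
  then show ?case
    by (simp add: differentiable_imp_continuous_on)
next
  case (Suc k)
  show ?case
    using Suc.prems Suc.IH by (subst C_k_on.simps) simp
qed

lemma C_k_on_const: "C_k_on k S (\<lambda>_. c)"
proof (induction k arbitrary: c)
  case (Suc k)
  then show ?case by (simp add: frechet_derivative_const)
qed simp

lemma frechet_derivative_sum_prod:
  fixes f h :: "'a::real_normed_vector \<Rightarrow> real"
  assumes "f differentiable (at x)" "h differentiable (at x)"
  shows "frechet_derivative (\<lambda>x. f x + h x) (at x) v =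
           frechet_derivative f (at x) v + frechet_derivative h (at x) v"
    and "frechet_derivative (\<lambda>x. f x * h x) (at x) v =
           f x * frechet_derivative h (at x) v + frechet_derivative f (at x) v * h x"
proof -
  note d = assms[unfolded frechet_derivative_works]
  show "frechet_derivative (\<lambda>x. f x + h x) (at x) v =
           frechet_derivative f (at x) v + frechet_derivative h (at x) v"
    by (simp flip: frechet_derivative_at[OF has_derivative_add[OF d]])
  show "frechet_derivative (\<lambda>x. f x * h x) (at x) v =
           f x * frechet_derivative h (at x) v + frechet_derivative f (at x) v * h x"
    by (simp flip: frechet_derivative_at[OF has_derivative_mult[OF d]])
qed

lemma C_k_on_add:
  fixes f h :: "'a::real_normed_vector \<Rightarrow> real"
  assumes "open S" "C_k_on k S f" "C_k_on k S h"
  shows "C_k_on k S (\<lambda>x. f x + h x)"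
  using assms(2,3)
proof (induction k arbitrary: f h)
  case 0
  then show ?case by (simp add: continuous_on_add)
next
  case (Suc k)
  have "C_k_on k S (\<lambda>x. frechet_derivative (\<lambda>x. f x + h x) (at x) v)" for v
    by (rule C_k_on_cong[OF assms(1) _ Suc.IH[of "\<lambda>x. frechet_derivative f (at x) v"
          "\<lambda>x. frechet_derivative h (at x) v"]])
      (use Suc.prems in \<open>simp_all add: frechet_derivative_sum_prod\<close>)
  then show ?case
    using Suc.prems by simp
qed

text \<open>The product rule also contains the undifferentiated factors, which are needed at order k
  while the hypothesis gives them at order k + 1; hence the use of
  \<open>C_k_on_SucD\<close>.\<close>

lemma C_k_on_mult:
  fixes f h :: "'a::real_normed_vector \<Rightarrow> real"
  assumes "open S" "C_k_on k S f" "C_k_on k S h"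
  shows "C_k_on k S (\<lambda>x. f x * h x)"
  using assms(2,3)
proof (induction k arbitrary: f h)
  case 0
  then show ?case by (simp add: continuous_on_mult)
next
  case (Suc k)
  have "C_k_on k S f" "C_k_on k S h"
    using Suc.prems C_k_on_SucD by blast+
  then have "C_k_on k S (\<lambda>x. f x * frechet_derivative h (at x) v)"
    "C_k_on k S (\<lambda>x. frechet_derivative f (at x) v * h x)" for v
    using Suc.prems by (simp_all add: Suc.IH)
  then have *: "C_k_on k S (\<lambda>x. f x * frechet_derivative h (at x) v +
      frechet_derivative f (at x) v * h x)" for v
    by (rule C_k_on_add[OF assms(1)])
  have "C_k_on k S (\<lambda>x. frechet_derivative (\<lambda>x. f x * h x) (at x) v)" for v
    by (rule C_k_on_cong[OF assms(1) _ *[of v]])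
      (use Suc.prems in \<open>simp add: frechet_derivative_sum_prod\<close>)
  then show ?case
    using Suc.prems by simp
qed

section \<open>Smooth functions, tangent vectors as derivations, vector fields\<close>

locale smooth_manifold =
  fixes A :: "('m::{t2_space,second_countable_topology}, 'e::euclidean_space) atlas"
  assumes atlas: "smooth_atlas A"
begin

lemma chart_image_open: "(U, \<phi>) \<in> A \<Longrightarrow> open (\<phi> ` U)"
  using atlas unfolding smooth_atlas_def by blast

lemma chart_inverse: "(U, \<phi>) \<in> A \<Longrightarrow> p \<in> U \<Longrightarrow> inv_into U \<phi> (\<phi> p) = p"
  using atlas unfolding smooth_atlas_def homeomorphism_def by fast

lemma chart_around:
  obtains U \<phi> where "(U, \<phi>) \<in> A" "p \<in> U"
proof -
  have "p \<in> (\<Union>(U, \<phi>)\<in>A. U)"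
    using atlas unfolding smooth_atlas_def by simp
  then show ?thesis using that by blast
qed

lemma smooth_fun_const [simp]: "smooth_fun A (\<lambda>_. c)"
  by (auto simp: smooth_fun_def smooth_on_def comp_def C_k_on_const)

lemma smooth_fun_add [simp]:
  "smooth_fun A f \<Longrightarrow> smooth_fun A h \<Longrightarrow> smooth_fun A (\<lambda>p. f p + h p)"
  unfolding smooth_fun_def smooth_on_def comp_def
  by (auto intro!: C_k_on_add chart_image_open split: prod.splits)

lemma smooth_fun_mult [simp]:
  "smooth_fun A f \<Longrightarrow> smooth_fun A h \<Longrightarrow> smooth_fun A (\<lambda>p. f p * h p)"
  unfolding smooth_fun_def smooth_on_def comp_def
  by (auto intro!: C_k_on_mult chart_image_open split: prod.splits)

lemma smooth_fun_uminus [simp]: "smooth_fun A f \<Longrightarrow> smooth_fun A (\<lambda>p. - f p)"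
  using smooth_fun_mult[of "\<lambda>_. -1" f] by simp

lemma smooth_fun_diff [simp]:
  "smooth_fun A f \<Longrightarrow> smooth_fun A h \<Longrightarrow> smooth_fun A (\<lambda>p. f p - h p)"
  using smooth_fun_add[of f "\<lambda>p. - h p"] by simp

lemma smooth_fun_differentiable:
  assumes "smooth_fun A f" "(U, \<phi>) \<in> A" "p \<in> U"
  shows "(f \<circ> inv_into U \<phi>) differentiable (at (\<phi> p))"
proof -
  have "C_k_on (Suc 0) (\<phi> ` U) (f \<circ> inv_into U \<phi>)"
    using assms unfolding smooth_fun_def smooth_on_def by blast
  then show ?thesis using assms(3) by simp
qed

text \<open>Identities between values of a tangent vector need only one chart around the point,
  although the definition describes the vector in all of them. Membership proofs, in contrast, go
  through every chart.\<close>

lemma tangent_chartE: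
  assumes "v \<in> tangent_space A p"
  obtains U \<phi> a where "(U, \<phi>) \<in> A" "p \<in> U"
    "\<And>f. smooth_fun A f \<Longrightarrow> v f = frechet_derivative (f \<circ> inv_into U \<phi>) (at (\<phi> p)) a"
proof -
  obtain U \<phi> where c: "(U, \<phi>) \<in> A" "p \<in> U" by (rule chart_around)
  then obtain a where "\<And>f. smooth_fun A f \<Longrightarrow>
      v f = frechet_derivative (f \<circ> inv_into U \<phi>) (at (\<phi> p)) a"
    using assms unfolding tangent_space_def by blast
  with c that show ?thesis by blast
qed

lemma tangent_nonsmooth: "v \<in> tangent_space A p \<Longrightarrow> \<not> smooth_fun A f \<Longrightarrow> v f = 0"
  by (simp add: tangent_space_def)

lemma tangent_const: "v \<in> tangent_space A p \<Longrightarrow> v (\<lambda>_. c) = 0"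
  by (erule tangent_chartE) (simp add: comp_def frechet_derivative_const)

lemma tangent_sum:
  assumes "v \<in> tangent_space A p" "smooth_fun A f" "smooth_fun A h"
  shows "v (\<lambda>q. f q + h q) = v f + v h"
proof -
  obtain U \<phi> a where c: "(U, \<phi>) \<in> A" "p \<in> U"
    and v: "\<And>f. smooth_fun A f \<Longrightarrow> v f = frechet_derivative (f \<circ> inv_into U \<phi>) (at (\<phi> p)) a"
    using tangent_chartE[OF assms(1)] by metis
  show ?thesis
    using frechet_derivative_sum_prod(1)[OF smooth_fun_differentiable[OF assms(2) c]
        smooth_fun_differentiable[OF assms(3) c]]
    by (simp add: v assms(2,3)) (simp add: comp_def)
qed

lemma tangent_Leibniz:
  assumes "v \<in> tangent_space A p" "smooth_fun A f" "smooth_fun A h"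
  shows "v (\<lambda>q. f q * h q) = f p * v h + v f * h p"
proof -
  obtain U \<phi> a where c: "(U, \<phi>) \<in> A" "p \<in> U"
    and v: "\<And>f. smooth_fun A f \<Longrightarrow> v f = frechet_derivative (f \<circ> inv_into U \<phi>) (at (\<phi> p)) a"
    using tangent_chartE[OF assms(1)] by metis
  show ?thesis
    using frechet_derivative_sum_prod(2)[OF smooth_fun_differentiable[OF assms(2) c]
        smooth_fun_differentiable[OF assms(3) c], of a]
    by (simp add: v assms(2,3)) (simp add: comp_def chart_inverse[OF c])
qed

lemma tangent_spaceI:
  assumes "\<And>U \<phi>. (U, \<phi>) \<in> A \<Longrightarrow> p \<in> U \<Longrightarrow>
      \<exists>a. \<forall>f. smooth_fun A f \<longrightarrow> v f = frechet_derivative (f \<circ> inv_into U \<phi>) (at (\<phi> p)) a"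
    and "\<And>f. \<not> smooth_fun A f \<Longrightarrow> v f = 0"
  shows "v \<in> tangent_space A p"
  using assms by (auto simp: tangent_space_def)

lemma tangent_in_chartE:
  assumes "v \<in> tangent_space A p" "(U, \<phi>) \<in> A" "p \<in> U"
  obtains a where
    "\<And>f. smooth_fun A f \<Longrightarrow> v f = frechet_derivative (f \<circ> inv_into U \<phi>) (at (\<phi> p)) a"
  using assms by (auto simp: tangent_space_def)

text \<open>In each chart the coordinate vectors add up, because the Frechet derivative is linear at
  a point of differentiability. This is where smoothness of the test function is used.\<close>

lemma tangent_add_mem [simp]:
  assumes "v \<in> tangent_space A p" "w \<in> tangent_space A p"
  shows "v + w \<in> tangent_space A p"
proof (rule tangent_spaceI)
  fix U \<phi>
  assume c: "(U, \<phi>) \<in> A" "p \<in> U"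
  obtain a b where
    "\<And>f. smooth_fun A f \<Longrightarrow> v f = frechet_derivative (f \<circ> inv_into U \<phi>) (at (\<phi> p)) a"
    "\<And>f. smooth_fun A f \<Longrightarrow> w f = frechet_derivative (f \<circ> inv_into U \<phi>) (at (\<phi> p)) b"
    using tangent_in_chartE[OF assms(1) c] tangent_in_chartE[OF assms(2) c] by metis
  then have "(v + w) f = frechet_derivative (f \<circ> inv_into U \<phi>) (at (\<phi> p)) (a + b)"
    if "smooth_fun A f" for f
    using that linear_add[OF linear_frechet_derivative[OF smooth_fun_differentiable[OF that c]]]
    by simp
  then show "\<exists>a. \<forall>f. smooth_fun A f \<longrightarrow>
      (v + w) f = frechet_derivative (f \<circ> inv_into U \<phi>) (at (\<phi> p)) a"
    by blast
qed (simp add: tangent_nonsmooth[OF assms(1)] tangent_nonsmooth[OF assms(2)])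

lemma tangent_scale_mem [simp]:
  assumes "v \<in> tangent_space A p"
  shows "scale_tangent k v \<in> tangent_space A p"
proof (rule tangent_spaceI)
  fix U \<phi>
  assume c: "(U, \<phi>) \<in> A" "p \<in> U"
  obtain a where
    "\<And>f. smooth_fun A f \<Longrightarrow> v f = frechet_derivative (f \<circ> inv_into U \<phi>) (at (\<phi> p)) a"
    using tangent_in_chartE[OF assms c] by metis
  then have "scale_tangent k v f = frechet_derivative (f \<circ> inv_into U \<phi>) (at (\<phi> p)) (k *\<^sub>R a)"
    if "smooth_fun A f" for f
    using that linear_cmul[OF linear_frechet_derivative[OF smooth_fun_differentiable[OF that c]]]
    by (simp add: scale_tangent_def)
  then show "\<exists>a. \<forall>f. smooth_fun A f \<longrightarrow>
      scale_tangent k v f = frechet_derivative (f \<circ> inv_into U \<phi>) (at (\<phi> p)) a"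
    by blast
qed (simp add: tangent_nonsmooth[OF assms] scale_tangent_def)

lemma vf_tangent: "X \<in> vector_fields A \<Longrightarrow> X p \<in> tangent_space A p"
  by (simp add: vector_fields_def)

lemma vf_app_smooth [simp]: "X \<in> vector_fields A \<Longrightarrow> smooth_fun A f \<Longrightarrow> smooth_fun A (app X f)"
  by (simp add: vector_fields_def)

lemma vf_add [simp]:
  "X \<in> vector_fields A \<Longrightarrow> Y \<in> vector_fields A \<Longrightarrow> X + Y \<in> vector_fields A"
  using smooth_fun_add[of "app X f" "app Y f" for f]
  by (simp add: vector_fields_def app_def)

lemma vf_fscale [simp]:
  "X \<in> vector_fields A \<Longrightarrow> smooth_fun A h \<Longrightarrow> fscale h X \<in> vector_fields A"
  using smooth_fun_mult[of h "app X f" for f] tangent_scale_mem[of "X p" p "h p" for p]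
  by (simp add: vector_fields_def app_def fscale_def) (simp add: scale_tangent_def)

lemma vf_rscale [simp]: "X \<in> vector_fields A \<Longrightarrow> rscale c X \<in> vector_fields A"
  by (simp add: rscale_def)

lemma vf_uminus [simp]: "X \<in> vector_fields A \<Longrightarrow> - X \<in> vector_fields A"
  using vf_rscale[of X "-1"] by (simp add: rscale_def fscale_def scale_tangent_def fun_Compl_def)

lemma vf_diff [simp]:
  "X \<in> vector_fields A \<Longrightarrow> Y \<in> vector_fields A \<Longrightarrow> X - Y \<in> vector_fields A"
  using vf_add[of X "- Y"] by simp

lemma app_const [simp]: "X \<in> vector_fields A \<Longrightarrow> app X (\<lambda>_. c) = 0"
  by (simp add: app_def fun_eq_iff tangent_const[OF vf_tangent])

lemma app_add:
  "X \<in> vector_fields A \<Longrightarrow> smooth_fun A f \<Longrightarrow> smooth_fun A h \<Longrightarrow>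
     app X (\<lambda>q. f q + h q) = (\<lambda>q. app X f q + app X h q)"
  by (simp add: app_def fun_eq_iff tangent_sum[OF vf_tangent])

lemma app_mult:
  "X \<in> vector_fields A \<Longrightarrow> smooth_fun A f \<Longrightarrow> smooth_fun A h \<Longrightarrow>
     app X (\<lambda>q. f q * h q) = (\<lambda>q. f q * app X h q + app X f q * h q)"
  by (simp add: app_def fun_eq_iff tangent_Leibniz[OF vf_tangent])

lemma app_nonsmooth: "X \<in> vector_fields A \<Longrightarrow> \<not> smooth_fun A f \<Longrightarrow> app X f = (\<lambda>_. 0)"
  by (simp add: app_def fun_eq_iff tangent_nonsmooth[OF vf_tangent])

section \<open>Leibniz rules for the bracket\<close>

lemma bracket_add_left:
  assumes "X \<in> vector_fields A" "Y \<in> vector_fields A" "Z \<in> vector_fields A"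
  shows "bracket (X + Y) Z = bracket X Z + bracket Y Z"
proof -
  have "Z p (app (X + Y) f) = Z p (app X f) + Z p (app Y f)" for p f
  proof (cases "smooth_fun A f")
    case True
    then show ?thesis
      using fun_cong[OF app_add[OF assms(3) vf_app_smooth[OF assms(1) True]
            vf_app_smooth[OF assms(2) True]], of p]
      by (simp add: app_def)
  next
    \<comment> \<open>On a function that is not smooth every vector field takes the default value 0,
      so \<open>app X f\<close> is the zero function. That one is smooth and constant, hence killed
      by \<open>Z p\<close>.\<close>
    case False
    then show ?thesis
      using assms tangent_const[OF vf_tangent] by (simp add: app_nonsmooth)
  qed
  then show ?thesis
    by (simp add: bracket_def fun_eq_iff)
qed

lemma bracket_fscale_left:
  assumes "X \<in> vector_fields A" "Y \<in> vector_fields A" "smooth_fun A h"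
  shows "bracket (fscale h X) Y = fscale h (bracket X Y) - fscale (app Y h) X"
proof -
  have "Y p (app (fscale h X) f) = h p * Y p (app X f) + Y p h * X p f" for p f
  proof (cases "smooth_fun A f")
    case True
    then show ?thesis
      using fun_cong[OF app_mult[OF assms(2,3) vf_app_smooth[OF assms(1) True]], of p]
      by (simp add: app_def fscale_def scale_tangent_def)
  next
    case False
    then show ?thesis
      using assms
      by (simp add: app_nonsmooth tangent_const[OF vf_tangent[OF assms(2)]]
          tangent_nonsmooth[OF vf_tangent[OF assms(1)]])
  qed
  then show ?thesis
    by (simp add: bracket_def fun_eq_iff fscale_def scale_tangent_def app_def algebra_simps)
qed

lemma bracket_antisym: "bracket Y X = - bracket X Y"
  by (simp add: bracket_def fun_eq_iff)

lemma bracket_add_right: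
  assumes "X \<in> vector_fields A" "Y \<in> vector_fields A" "Z \<in> vector_fields A"
  shows "bracket Z (X + Y) = bracket Z X + bracket Z Y"
  using bracket_add_left[OF assms] by (simp add: bracket_antisym[of Z])

lemma bracket_fscale_right:
  assumes "X \<in> vector_fields A" "Y \<in> vector_fields A" "smooth_fun A h"
  shows "bracket Y (fscale h X) = fscale (app Y h) X + fscale h (bracket Y X)"
  using bracket_fscale_left[OF assms]
  by (simp add: bracket_antisym[of Y] fscale_def scale_tangent_def fun_eq_iff)

end

section \<open>Connections, curvature and tensors\<close>

lemmas vfield_ops = fun_eq_iff fscale_def rscale_def scale_tangent_def

lemma rscale_simps:
  "rscale a (rscale b X) = rscale (a * b) X"
  "rscale a (X + Y) = rscale a X + rscale a Y"
  "rscale a (X - Y) = rscale a X - rscale a Y"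
  "rscale a (- X) = rscale (- a) X"
  "- rscale a X = rscale (- a) X"
  "rscale 0 X = 0" "rscale a 0 = 0" "rscale 1 X = X"
  by (simp_all add: vfield_ops algebra_simps)

text \<open>Encoded as bilinearity over smooth functions on vector fields, not as a field of
  bilinear forms, since the Ricci form and its Lie derivative are given only as operations on vector
  fields.\<close>

definition tensor_0_2 ::
  "('m, 'e::euclidean_space) atlas \<Rightarrow> ('m vfield \<Rightarrow> 'm vfield \<Rightarrow> 'm \<Rightarrow> real) \<Rightarrow> bool" where
  "tensor_0_2 A T \<longleftrightarrow>
     (\<forall>X\<in>vector_fields A. \<forall>Y\<in>vector_fields A.
        smooth_fun A (T X Y) \<and>
        (\<forall>Z\<in>vector_fields A. T (X + Z) Y = T X Y + T Z Y \<and> T X (Y + Z) = T X Y + T X Z) \<and>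
        (\<forall>f. smooth_fun A f \<longrightarrow>
           T (fscale f X) Y = (\<lambda>p. f p * T X Y p) \<and> T X (fscale f Y) = (\<lambda>p. f p * T X Y p)))"

lemma tensor_0_2D:
  assumes "tensor_0_2 A T" "X \<in> vector_fields A" "Y \<in> vector_fields A"
  shows "smooth_fun A (T X Y)"
    and "Z \<in> vector_fields A \<Longrightarrow> T (X + Z) Y = T X Y + T Z Y"
    and "Z \<in> vector_fields A \<Longrightarrow> T X (Y + Z) = T X Y + T X Z"
    and "smooth_fun A f \<Longrightarrow> T (fscale f X) Y = (\<lambda>p. f p * T X Y p)"
    and "smooth_fun A f \<Longrightarrow> T X (fscale f Y) = (\<lambda>p. f p * T X Y p)"
  using assms unfolding tensor_0_2_def by blast+

context smooth_manifold
begin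

lemma affine_connectionD:
  assumes "affine_connection A D" "X \<in> vector_fields A" "Y \<in> vector_fields A"
  shows "D X Y \<in> vector_fields A"
    and "Z \<in> vector_fields A \<Longrightarrow> D (X + Z) Y = D X Y + D Z Y"
    and "Z \<in> vector_fields A \<Longrightarrow> D X (Y + Z) = D X Y + D X Z"
    and "smooth_fun A f \<Longrightarrow> D (fscale f X) Y = fscale f (D X Y)"
    and "smooth_fun A f \<Longrightarrow> D X (fscale f Y) = fscale (app X f) Y + fscale f (D X Y)"
  using assms unfolding affine_connection_def by blast+

lemma vf_zero [simp]: "X \<in> vector_fields A \<Longrightarrow> 0 \<in> vector_fields A"
  using vf_rscale[of X 0] by (simp add: rscale_simps)

text \<open>Constants are smooth functions with zero derivative, so the Leibniz term disappears; the
  factors -1 and 0 then give negation, difference and zero.\<close>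

lemma affine_connection_linear:
  assumes "affine_connection A D" "X \<in> vector_fields A" "Y \<in> vector_fields A"
  shows "D (rscale c X) Y = rscale c (D X Y)"
    and "D X (rscale c Y) = rscale c (D X Y)"
    and "D (- X) Y = - D X Y"
    and "D X (- Y) = - D X Y"
    and "D 0 Y = 0"
    and "D X 0 = 0"
    and "Z \<in> vector_fields A \<Longrightarrow> D (X - Z) Y = D X Y - D Z Y"
    and "Z \<in> vector_fields A \<Longrightarrow> D X (Y - Z) = D X Y - D X Z"
proof -
  note d = affine_connectionD[OF assms(1)]
  have l: "D (rscale c X) Y = rscale c (D X Y)" if "X \<in> vector_fields A" "Y \<in> vector_fields A"
    for c X Y
    using d(4)[OF that, of "\<lambda>_. c"] by (simp add: rscale_def)
  have r: "D X (rscale c Y) = rscale c (D X Y)" if "X \<in> vector_fields A" "Y \<in> vector_fields A"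
    for c X Y
    using d(5)[OF that, of "\<lambda>_. c"] that by (simp add: vfield_ops)
  have m: "- X = rscale (-1) X" for X :: "'m vfield"
    by (simp add: vfield_ops)
  show "D (rscale c X) Y = rscale c (D X Y)" "D X (rscale c Y) = rscale c (D X Y)"
    using assms l r by blast+
  show "D (- X) Y = - D X Y" "D X (- Y) = - D X Y"
    unfolding m using assms l r by blast+
  show "D 0 Y = 0" "D X 0 = 0"
    using l[of X Y 0] r[of X Y 0] assms by (simp_all add: rscale_simps)
  show "D (X - Z) Y = D X Y - D Z Y" "D X (Y - Z) = D X Y - D X Z" if "Z \<in> vector_fields A"
    using d(2)[OF assms(2,3) vf_uminus[OF that]] d(3)[OF assms(2,3) vf_uminus[OF that]]
      l[OF that assms(3), of "-1"] r[OF assms(2) that, of "-1"]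
    by (simp_all add: rscale_simps flip: m)
qed

lemma tensor_1_1_linear:
  assumes "tensor_1_1 A J" "X \<in> vector_fields A"
  shows "endo_app J X \<in> vector_fields A"
    and "Y \<in> vector_fields A \<Longrightarrow> endo_app J (X + Y) = endo_app J X + endo_app J Y"
    and "endo_app J (fscale f X) = fscale f (endo_app J X)"
    and "endo_app J (rscale c X) = rscale c (endo_app J X)"
    and "endo_app J (- X) = - endo_app J X"
    and "endo_app J 0 = 0"
proof -
  show 1: "endo_app J X \<in> vector_fields A"
    using assms by (simp add: tensor_1_1_def)
  show 2: "endo_app J (X + Y) = endo_app J X + endo_app J Y" if "Y \<in> vector_fields A"
    using assms that vf_tangent by (simp add: tensor_1_1_def endo_app_def fun_eq_iff)
  show 3: "endo_app J (fscale f X) = fscale f (endo_app J X)" for f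
    using assms vf_tangent by (simp add: tensor_1_1_def endo_app_def fscale_def)
  show 4: "endo_app J (rscale c X) = rscale c (endo_app J X)" for c
    by (simp add: rscale_def 3)
  show "endo_app J (- X) = - endo_app J X"
    using 4[of "-1"] by (simp add: vfield_ops fun_Compl_def)
  show "endo_app J 0 = 0"
    using 4[of 0] by (simp add: rscale_simps)
qed

text \<open>By J^2 = id, the field (\<nabla>_X J)(J Y) equals \<nabla>_X Y - J \<nabla>_X (J Y). The
  canonical connection is thus the average of \<nabla> and its conjugate by J.\<close>

lemma canonical_connection_eq:
  assumes "affine_connection A D" "left_invariant_product_structure m A J"
    and "X \<in> vector_fields A" "Y \<in> vector_fields A"
  shows "canonical_connection D J X Y =
           rscale (1/2) (D X Y + endo_app J (D X (endo_app J Y)))"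
proof -
  have "endo_app J (endo_app J Y) = Y"
    using assms(2,4) vf_tangent by (auto simp: left_invariant_product_structure_def endo_app_def)
  then show ?thesis
    by (simp add: canonical_connection_def cov_endo_def) (simp add: vfield_ops algebra_simps)
qed

text \<open>An average of two connections: each of the two contributes half of the Leibniz term X(f)
  Y, the conjugate one through J J Y = Y.\<close>

lemma canonical_connection_affine:
  assumes D: "affine_connection A D" and J: "left_invariant_product_structure m A J"
  shows "affine_connection A (canonical_connection D J)"
proof -
  have J11: "tensor_1_1 A J"
    using J by (simp add: left_invariant_product_structure_def)
  have JJ: "endo_app J (endo_app J Y) = Y" if "Y \<in> vector_fields A" for Y
    using J vf_tangent that by (auto simp: left_invariant_product_structure_def endo_app_def)
  note simps = canonical_connection_eq[OF D J] affine_connectionD[OF D] tensor_1_1_linear[OF J11]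
  show ?thesis
    unfolding affine_connection_def
  proof (intro ballI conjI allI impI)
    fix X Y assume XY: "X \<in> vector_fields A" "Y \<in> vector_fields A"
    show "canonical_connection D J X Y \<in> vector_fields A"
      using XY by (simp add: simps)
    show "canonical_connection D J (X + Z) Y =
        canonical_connection D J X Y + canonical_connection D J Z Y"
      "canonical_connection D J X (Y + Z) =
        canonical_connection D J X Y + canonical_connection D J X Z" if "Z \<in> vector_fields A" for Z
      using XY that by (simp_all add: simps rscale_simps)
    show "canonical_connection D J (fscale f X) Y = fscale f (canonical_connection D J X Y)"
      "canonical_connection D J X (fscale f Y) =
        fscale (app X f) Y + fscale f (canonical_connection D J X Y)" if "smooth_fun A f" for f
      using XY that by (simp_all add: simps JJ) (simp_all add: vfield_ops algebra_simps)
  qed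
qed

lemma tensor_rscale:
  assumes "tensor_0_2 A T" "X \<in> vector_fields A" "Y \<in> vector_fields A"
  shows "T (rscale c X) Y p = c * T X Y p" "T X (rscale c Y) p = c * T X Y p"
  using tensor_0_2D(4,5)[OF assms, of "\<lambda>_. c"] by (simp_all add: rscale_def)

lemma bracket_rscale_left:
  assumes "X \<in> vector_fields A" "Y \<in> vector_fields A"
  shows "bracket (rscale c X) Y = rscale c (bracket X Y)"
  using bracket_fscale_left[OF assms, of "\<lambda>_. c"] assms by (simp add: vfield_ops)

lemma levi_civitaD:
  assumes "levi_civita A g D"
  shows "affine_connection A D"
    and "X \<in> vector_fields A \<Longrightarrow> Y \<in> vector_fields A \<Longrightarrow> D X Y - D Y X = bracket X Y"
    and "X \<in> vector_fields A \<Longrightarrow> Y \<in> vector_fields A \<Longrightarrow> Z \<in> vector_fields A \<Longrightarrow>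
      app X (inner_fun g Y Z) = inner_fun g (D X Y) Z + inner_fun g Y (D X Z)"
  using assms unfolding levi_civita_def by blast+

end

section \<open>Tensoriality of curvature, Ricci form and Lie derivative\<close>

locale lorentzian_manifold = smooth_manifold A
  for A :: "('m::{t2_space,second_countable_topology}, real^3) atlas" +
  fixes g :: "'m metric" and nabla :: "'m connection"
  assumes metric: "lorentzian_metric A g"
    and levi_civita: "levi_civita A g nabla"
begin

text \<open>Torsion-freeness of \<open>nabla\<close> replaces the direct proof by symmetry of second derivatives.\<close>

lemma vf_bracket [simp]:
  "X \<in> vector_fields A \<Longrightarrow> Y \<in> vector_fields A \<Longrightarrow> bracket X Y \<in> vector_fields A"
  using levi_civitaD(1)[OF levi_civita] levi_civitaD(2)[OF levi_civita, of X Y]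
  by (metis affine_connectionD(1) vf_diff)

lemma metric_linear:
  assumes "v \<in> tangent_space A p" "w \<in> tangent_space A p"
  shows "g p v w = g p w v"
    and "g p (scale_tangent c v) w = c * g p v w"
    and "v' \<in> tangent_space A p \<Longrightarrow> g p (v + v') w = g p v w + g p v' w"
  using metric assms unfolding lorentzian_metric_def by blast+

lemma inner_fun_smooth [simp]:
  "X \<in> vector_fields A \<Longrightarrow> Y \<in> vector_fields A \<Longrightarrow> smooth_fun A (inner_fun g X Y)"
  using metric unfolding lorentzian_metric_def by blast

lemma inner_fun_linear:
  assumes "X \<in> vector_fields A" "Y \<in> vector_fields A"
  shows "Z \<in> vector_fields A \<Longrightarrow> inner_fun g (X + Z) Y = inner_fun g X Y + inner_fun g Z Y"
    and "inner_fun g (fscale f X) Y = (\<lambda>p. f p * inner_fun g X Y p)"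
    and "inner_fun g (rscale c X) Y = (\<lambda>p. c * inner_fun g X Y p)"
    and "inner_fun g (- X) Y = - inner_fun g X Y"
    and "Z \<in> vector_fields A \<Longrightarrow> inner_fun g (X - Z) Y = inner_fun g X Y - inner_fun g Z Y"
    and "inner_fun g 0 Y = 0"
    and "inner_fun g X Y = inner_fun g Y X"
proof -
  have 1: "inner_fun g (X + Z) Y = inner_fun g X Y + inner_fun g Z Y"
    if "X \<in> vector_fields A" "Z \<in> vector_fields A" for X Z
    using assms that metric_linear(3) vf_tangent by (simp add: inner_fun_def fun_eq_iff)
  have 2: "inner_fun g (fscale f X) Y = (\<lambda>p. f p * inner_fun g X Y p)"
    if "X \<in> vector_fields A" for f X
    using assms that metric_linear(2) vf_tangent by (simp add: inner_fun_def fscale_def fun_eq_iff)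
  have 3: "inner_fun g (rscale c X) Y = (\<lambda>p. c * inner_fun g X Y p)"
    if "X \<in> vector_fields A" for c X
    by (simp add: rscale_def 2 that)
  have m: "- X = rscale (-1) X" for X :: "'m vfield"
    by (simp add: vfield_ops)
  have 4: "inner_fun g (- X) Y = - inner_fun g X Y" if "X \<in> vector_fields A" for X
    by (simp add: m 3 that fun_eq_iff)
  show "Z \<in> vector_fields A \<Longrightarrow> inner_fun g (X + Z) Y = inner_fun g X Y + inner_fun g Z Y"
    "inner_fun g (fscale f X) Y = (\<lambda>p. f p * inner_fun g X Y p)"
    "inner_fun g (rscale c X) Y = (\<lambda>p. c * inner_fun g X Y p)"
    "inner_fun g (- X) Y = - inner_fun g X Y"
    using 1 2 3 4 assms(1) by blast+
  show "inner_fun g (X - Z) Y = inner_fun g X Y - inner_fun g Z Y" if "Z \<in> vector_fields A"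
    using 1[OF assms(1) vf_uminus[OF that]] 4[OF that] by simp
  show "inner_fun g 0 Y = 0"
    using 3[OF assms(1), of 0] by (simp add: rscale_simps zero_fun_def)
  show "inner_fun g X Y = inner_fun g Y X"
    using assms metric_linear(1) vf_tangent by (simp add: inner_fun_def fun_eq_iff)
qed

text \<open>Only the first and third slots are treated: these are where the arguments of
  \<open>ricci\<close> go, while the middle slot always holds a fixed frame field.\<close>

lemma curvature_tensorial:
  assumes D: "affine_connection A D"
    and v: "X \<in> vector_fields A" "Y \<in> vector_fields A" "Z \<in> vector_fields A"
  shows "curvature D X Y Z \<in> vector_fields A"
    and "W \<in> vector_fields A \<Longrightarrow> curvature D (X + W) Y Z = curvature D X Y Z + curvature D W Y Z"
    and "W \<in> vector_fields A \<Longrightarrow> curvature D X Y (Z + W) = curvature D X Y Z + curvature D X Y W"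
    and "smooth_fun A f \<Longrightarrow> curvature D (fscale f X) Y Z = fscale f (curvature D X Y Z)"
    and "smooth_fun A f \<Longrightarrow> curvature D X Y (fscale f Z) = fscale f (curvature D X Y Z)"
proof -
  note simps = affine_connectionD[OF D] affine_connection_linear[OF D] curvature_def
  show "curvature D X Y Z \<in> vector_fields A"
    using v by (simp add: simps)
  show "curvature D (X + W) Y Z = curvature D X Y Z + curvature D W Y Z"
    "curvature D X Y (Z + W) = curvature D X Y Z + curvature D X Y W" if "W \<in> vector_fields A"
    using v that by (simp_all add: simps bracket_add_left)
  assume f: "smooth_fun A f"
  show "curvature D (fscale f X) Y Z = fscale f (curvature D X Y Z)"
    using v f by (simp add: simps bracket_fscale_left) (simp add: vfield_ops algebra_simps)
  \<comment> \<open>First-order derivatives of f cancel between the two iterated connection terms;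
    the remaining second-order ones form this commutator, which the bracket term of the curvature
    removes.\<close>
  have "app (bracket X Y) f = app X (app Y f) - app Y (app X f)"
    by (simp add: bracket_def app_def fun_eq_iff)
  with v f show "curvature D X Y (fscale f Z) = fscale f (curvature D X Y Z)"
    by (simp add: simps) (simp add: vfield_ops algebra_simps)
qed

lemma ricci_tensor:
  assumes D: "affine_connection A D" and e: "\<And>k. e k \<in> vector_fields A"
  shows "tensor_0_2 A (ricci g e D)"
  unfolding tensor_0_2_def
proof (intro ballI conjI allI impI)
  note simps = ricci_def curvature_tensorial[OF D] inner_fun_linear(1-2) e
  fix X Y assume XY: "X \<in> vector_fields A" "Y \<in> vector_fields A"
  show "smooth_fun A (ricci g e D X Y)"
    using XY by (simp add: simps plus_fun_def fun_diff_def fun_Compl_def)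
  show "ricci g e D (X + Z) Y = ricci g e D X Y + ricci g e D Z Y"
    "ricci g e D X (Y + Z) = ricci g e D X Y + ricci g e D X Z" if "Z \<in> vector_fields A" for Z
    using XY that by (simp_all add: simps)
  show "ricci g e D (fscale f X) Y = (\<lambda>p. f p * ricci g e D X Y p)"
    "ricci g e D X (fscale f Y) = (\<lambda>p. f p * ricci g e D X Y p)" if "smooth_fun A f" for f
    using XY that by (simp_all add: simps) (simp_all add: fun_eq_iff algebra_simps)
qed

lemma ricci_sym_tensor:
  assumes D: "affine_connection A D" and e: "\<And>k. e k \<in> vector_fields A"
  shows "tensor_0_2 A (ricci_sym g e D)"
  unfolding tensor_0_2_def
proof (intro ballI conjI allI impI)
  have R: "tensor_0_2 A (ricci g e D)"
    using D e by (rule ricci_tensor)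
  note simps = ricci_sym_def tensor_0_2D[OF R]
  fix X Y assume XY: "X \<in> vector_fields A" "Y \<in> vector_fields A"
  show "smooth_fun A (ricci_sym g e D X Y)"
    using smooth_fun_mult[OF smooth_fun_const[of "1/2"] smooth_fun_add[OF tensor_0_2D(1)[OF R XY]
          tensor_0_2D(1)[OF R XY(2,1)]]]
    by (simp add: ricci_sym_def)
  show "ricci_sym g e D (X + Z) Y = ricci_sym g e D X Y + ricci_sym g e D Z Y"
    "ricci_sym g e D X (Y + Z) = ricci_sym g e D X Y + ricci_sym g e D X Z"
    if "Z \<in> vector_fields A" for Z
    using XY that by (simp_all add: simps) (simp_all add: fun_eq_iff algebra_simps add_divide_distrib)
  show "ricci_sym g e D (fscale f X) Y = (\<lambda>p. f p * ricci_sym g e D X Y p)"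
    "ricci_sym g e D X (fscale f Y) = (\<lambda>p. f p * ricci_sym g e D X Y p)" if "smooth_fun A f" for f
    using XY that by (simp_all add: simps) (simp_all add: fun_eq_iff algebra_simps)
qed

text \<open>Differentiating f T(X,Y) along \<xi> produces \<xi>(f) T(X,Y). The bracket [\<xi>, f X]
  = \<xi>(f) X + f [\<xi>, X] produces the same term with the opposite sign, and likewise in the
  other slot.\<close>

lemma lie_derivative_tensor:
  assumes T: "tensor_0_2 A T" and \<xi>: "\<xi> \<in> vector_fields A"
  shows "tensor_0_2 A (lie_derivative \<xi> T)"
  unfolding tensor_0_2_def
proof (intro ballI conjI allI impI)
  note simps = lie_derivative_def tensor_0_2D[OF T] bracket_add_right bracket_fscale_right
    app_mult
  have app_sum: "app \<xi> (f + h) = app \<xi> f + app \<xi> h" if "smooth_fun A f" "smooth_fun A h" for f h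
    using app_add[OF \<xi> that] by (simp add: plus_fun_def)
  fix X Y assume XY: "X \<in> vector_fields A" "Y \<in> vector_fields A"
  show "smooth_fun A (lie_derivative \<xi> T X Y)"
    using XY \<xi> by (simp add: simps fun_diff_def)
  show "lie_derivative \<xi> T (X + Z) Y = lie_derivative \<xi> T X Y + lie_derivative \<xi> T Z Y"
    "lie_derivative \<xi> T X (Y + Z) = lie_derivative \<xi> T X Y + lie_derivative \<xi> T X Z"
    if "Z \<in> vector_fields A" for Z
    using XY \<xi> that app_sum by (simp_all add: simps)
  show "lie_derivative \<xi> T (fscale f X) Y = (\<lambda>p. f p * lie_derivative \<xi> T X Y p)"
    "lie_derivative \<xi> T X (fscale f Y) = (\<lambda>p. f p * lie_derivative \<xi> T X Y p)"
    if "smooth_fun A f" for f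
    using XY \<xi> that by (simp_all add: simps) (simp_all add: fun_eq_iff algebra_simps)
qed

end

section \<open>Orthonormal frames\<close>

context lorentzian_manifold
begin

text \<open>Inner products recover the coordinates along an orthonormal family, with a sign in the
  timelike direction, so the family is independent. That it spans follows by comparing it with a
  basis of the tangent space, of dimension three.\<close>

lemma tangent_expand:
  assumes b: "\<And>k. b k \<in> tangent_space A p" "pseudo_orthonormal (g p) b"
    and v: "v \<in> tangent_space A p"
  shows "v = scale_tangent (g p v (b 1)) (b 1) + scale_tangent (g p v (b 2)) (b 2)
           + scale_tangent (- g p v (b 3)) (b 3)"
proof -
  define comb where "comb b c = (\<Sum>k\<in>UNIV. scale_tangent (c $ k) (b k))"
    for b :: "3 \<Rightarrow> 'm tangent" and c :: "real^3"
  have comb_eq: "comb b c = scale_tangent (c $ 1) (b 1) + scale_tangent (c $ 2) (b 2)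
      + scale_tangent (c $ 3) (b 3)" for b c
    by (simp add: comb_def sum_3)
  have comb_mem: "comb b c \<in> tangent_space A p" if "\<And>k. b k \<in> tangent_space A p" for b c
    by (simp add: comb_eq that)
  have g_comb: "g p (comb b c) w = c $ 1 * g p (b 1) w + c $ 2 * g p (b 2) w + c $ 3 * g p (b 3) w"
    if "\<And>k. b k \<in> tangent_space A p" "w \<in> tangent_space A p" for b c w
    by (simp add: comb_eq metric_linear(2,3) that)
  have coord: "c = vector [g p (comb b c) (b 1), g p (comb b c) (b 2), - g p (comb b c) (b 3)]"
    if "\<And>k. b k \<in> tangent_space A p" "pseudo_orthonormal (g p) b" for b c
    using that(2) by (simp add: vec_eq_iff forall_3 g_comb that(1) pseudo_orthonormal_def)
  \<comment> \<open>The definition of a Lorentzian metric guarantees some orthonormal basis at p,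
    possibly different from \<open>b\<close>.\<close>
  obtain b' where b': "pseudo_orthonormal (g p) b'" "bij_betw (comb b') UNIV (tangent_space A p)"
    using metric unfolding lorentzian_metric_def comb_def by meson
  have b'_mem: "b' k \<in> tangent_space A p" for k
  proof -
    have "comb b' (axis k 1) = b' k"
      using exhaust_3[of k] by (auto simp: comb_eq axis_def scale_tangent_def fun_eq_iff)
    then show ?thesis
      using b'(2) by (metis UNIV_I bij_betw_apply)
  qed
  have surj: "\<exists>d. w = comb b' d" if "w \<in> tangent_space A p" for w
    using b'(2) that unfolding bij_betw_def by blast
  \<comment> \<open>\<open>L\<close> passes from coordinates along \<open>b\<close> to coordinates
    along \<open>b'\<close>. Injective and linear on a finite-dimensional space, it is onto, hence
    combinations of \<open>b\<close> reach every tangent vector.\<close>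
  define L :: "real^3 \<Rightarrow> real^3" where
    "L c = vector [g p (comb b c) (b' 1), g p (comb b c) (b' 2), - g p (comb b c) (b' 3)]" for c
  have L: "comb b' (L c) = comb b c" for c
  proof -
    obtain d where d: "comb b c = comb b' d"
      using surj comb_mem[of b c] b(1) by blast
    have "d = L c"
      using coord[OF b'_mem b'(1), where c = d] by (simp add: L_def d)
    then show ?thesis by (simp add: d)
  qed
  have "linear L"
    by (rule linearI)
      (simp_all add: L_def vec_eq_iff forall_3 g_comb b(1) b'_mem algebra_simps)
  moreover have "inj L"
  proof (rule injI)
    fix c d assume "L c = L d"
    then have "comb b c = comb b d" using L by metis
    then show "c = d"
      using coord[OF b, where c = c] coord[OF b, where c = d] by simp
  qed
  ultimately have "surj L"
    using linear_injective_imp_surjective by blast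
  then obtain c where c: "v = comb b c"
    using surj[OF v] L by (metis surjD)
  have *: "c $ 1 = g p v (b 1)" "c $ 2 = g p v (b 2)" "c $ 3 = - g p v (b 3)"
    using coord[OF b, where c = c] by (simp_all add: c vec_eq_iff forall_3)
  show ?thesis
    using comb_eq[of b c] unfolding c[symmetric] * .
qed

end

locale orthonormal_frame = lorentzian_manifold A g nabla
  for A :: "('m::{t2_space,second_countable_topology}, real^3) atlas" and g nabla +
  fixes e :: "3 \<Rightarrow> 'm vfield"
  assumes frame_vf [simp]: "e k \<in> vector_fields A"
    and frame_orthonormal: "pseudo_orthonormal (g p) (\<lambda>k. e k p)"
begin

lemma inner_frame [simp]:
  "inner_fun g (e 1) (e 1) = (\<lambda>_. 1)" "inner_fun g (e 2) (e 2) = (\<lambda>_. 1)"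
  "inner_fun g (e 3) (e 3) = (\<lambda>_. -1)"
  "j \<noteq> k \<Longrightarrow> inner_fun g (e j) (e k) = (\<lambda>_. 0)"
  using frame_orthonormal by (simp_all add: inner_fun_def pseudo_orthonormal_def)

lemma inner_frame_const: "\<exists>c. inner_fun g (e j) (e k) = (\<lambda>_. c)"
  using exhaust_3[of j] exhaust_3[of k] by auto

lemma vf_expand:
  assumes "X \<in> vector_fields A"
  shows "X = fscale (inner_fun g X (e 1)) (e 1) + fscale (inner_fun g X (e 2)) (e 2)
           + fscale (\<lambda>p. - inner_fun g X (e 3) p) (e 3)"
  using tangent_expand[of "\<lambda>k. e k p" p "X p" for p, OF vf_tangent[OF frame_vf] frame_orthonormal
      vf_tangent[OF assms]]
  by (simp add: fun_eq_iff[of X] fscale_def inner_fun_def)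

lemma vf_expand_const:
  assumes "X \<in> vector_fields A"
    and "\<And>p. inner_fun g X (e 1) p = a" "\<And>p. inner_fun g X (e 2) p = b"
    "\<And>p. inner_fun g X (e 3) p = c"
  shows "X = rscale a (e 1) + rscale b (e 2) + rscale (- c) (e 3)"
  using vf_expand[OF assms(1)] by (simp add: assms(2-) rscale_def fun_eq_iff fscale_def)

text \<open>The frame coefficients are smooth functions, so they can be pulled out of T, for one
  argument after the other.\<close>

lemma tensor_eq_0_iff_frame:
  assumes T: "tensor_0_2 A T"
  shows "(\<forall>X\<in>vector_fields A. \<forall>Y\<in>vector_fields A. T X Y = 0) \<longleftrightarrow> (\<forall>j k. T (e j) (e k) = 0)"
proof
  assume z: "\<forall>j k. T (e j) (e k) = 0"
  note t = tensor_0_2D[OF T]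
  have 1: "T X (e k) = 0" if "X \<in> vector_fields A" for X k
    by (subst vf_expand[OF that]) (simp add: t that z fun_eq_iff)
  have "T X Y = 0" if "X \<in> vector_fields A" "Y \<in> vector_fields A" for X Y
    by (subst vf_expand[OF that(2)]) (simp add: t that 1 fun_eq_iff)
  then show "\<forall>X\<in>vector_fields A. \<forall>Y\<in>vector_fields A. T X Y = 0" by blast
qed simp

text \<open>The derivative terms of the Koszul formula vanish on a frame with constant inner products.\<close>

lemma koszul_frame:
  "2 * inner_fun g (nabla (e i) (e j)) (e k) p =
     inner_fun g (bracket (e i) (e j)) (e k) p - inner_fun g (bracket (e j) (e k)) (e i) p
     + inner_fun g (bracket (e k) (e i)) (e j) p"
proof -
  define G where "G i j k = inner_fun g (nabla (e i) (e j)) (e k) p" for i j k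
  note lc = levi_civitaD[OF levi_civita]
  have mem: "nabla (e i) (e j) \<in> vector_fields A" for i j
    by (simp add: affine_connectionD(1)[OF lc(1)])
  have skew: "G i j k + G i k j = 0" for i j k
  proof -
    have "app (e i) (inner_fun g (e j) (e k)) = 0"
      using inner_frame_const[of j k] by (metis app_const frame_vf)
    then have "inner_fun g (nabla (e i) (e j)) (e k) + inner_fun g (e j) (nabla (e i) (e k)) = 0"
      using lc(3)[of "e i" "e j" "e k"] by simp
    then have "inner_fun g (nabla (e i) (e j)) (e k) p + inner_fun g (e j) (nabla (e i) (e k)) p = 0"
      by (metis plus_fun_apply zero_fun_apply)
    then show ?thesis
      using inner_fun_linear(7)[OF frame_vf mem, of j i k] by (simp add: G_def)
  qed
  have "inner_fun g (bracket (e i) (e j)) (e k) p = G i j k - G j i k" for i j k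
    using inner_fun_linear(5)[of "nabla (e i) (e j)" "e k" "nabla (e j) (e i)"]
      lc(2)[of "e i" "e j"]
    by (simp add: G_def mem)
  \<comment> \<open>The three brackets give six values of \<open>G\<close>; skew-symmetry in the
    last two indices cancels four of them and identifies the other two.\<close>
  then show ?thesis
    using skew[of i j k] skew[of j k i] skew[of k i j] by (simp add: G_def[symmetric])
qed

end

section \<open>The canonical connection and its Ricci collineations\<close>

locale group_G2_frame = orthonormal_frame A g nabla e
  for A :: "('m::{t2_space,second_countable_topology}, real^3) atlas" and g nabla e +
  fixes m :: "'m \<Rightarrow> 'm \<Rightarrow> 'm" and J :: "'m endo_field" and \<alpha> \<beta> \<gamma> :: real
  assumes bracket_12: "bracket (e 1) (e 2) = rscale \<gamma> (e 2) - rscale \<beta> (e 3)"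
    and bracket_13: "bracket (e 1) (e 3) = - rscale \<beta> (e 2) - rscale \<gamma> (e 3)"
    and bracket_23: "bracket (e 2) (e 3) = rscale \<alpha> (e 1)"
    and product_structure: "left_invariant_product_structure m A J"
    and J_frame [simp]: "endo_app J (e 1) = e 1" "endo_app J (e 2) = e 2" "endo_app J (e 3) = - e 3"
begin

abbreviation D0 :: "'m connection" where "D0 \<equiv> canonical_connection nabla J"

text \<open>Signs are moved into the scalars so that each right-hand side has one of the shapes
  handled by \<open>inner_combination\<close>.\<close>

lemma bracket_frame:
  "bracket (e k) (e k) = 0"
  "bracket (e 1) (e 2) = rscale \<gamma> (e 2) + rscale (- \<beta>) (e 3)"
  "bracket (e 2) (e 1) = rscale (- \<gamma>) (e 2) + rscale \<beta> (e 3)"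
  "bracket (e 1) (e 3) = rscale (- \<beta>) (e 2) + rscale (- \<gamma>) (e 3)"
  "bracket (e 3) (e 1) = rscale \<beta> (e 2) + rscale \<gamma> (e 3)"
  "bracket (e 2) (e 3) = rscale \<alpha> (e 1)"
  "bracket (e 3) (e 2) = rscale (- \<alpha>) (e 1)"
  using bracket_antisym[of "e 2" "e 1"] bracket_antisym[of "e 3" "e 1"]
    bracket_antisym[of "e 3" "e 2"]
  by (simp_all add: bracket_12 bracket_13 bracket_23) (simp_all add: bracket_def vfield_ops)

lemma inner_combination:
  "inner_fun g (rscale a (e j)) (e k) p = a * inner_fun g (e j) (e k) p"
  "inner_fun g (rscale a (e i) + rscale b (e j)) (e k) p =
     a * inner_fun g (e i) (e k) p + b * inner_fun g (e j) (e k) p"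
  "inner_fun g 0 (e k) p = 0"
  by (simp_all add: inner_fun_linear(1,3)) (simp add: inner_fun_linear(6)[of "e 1"])

text \<open>In each use of \<open>vf_expand_const\<close> the last three values are the inner
  products with \<open>e 1\<close>, \<open>e 2\<close>, \<open>e 3\<close> found by the Koszul
  formula. The third changes sign as a coefficient, since \<open>e 3\<close> is timelike.\<close>

lemma nabla_frame:
  "nabla (e 1) (e 1) = 0"
  "nabla (e 1) (e 2) = rscale (\<alpha> / 2 - \<beta>) (e 3)"
  "nabla (e 1) (e 3) = rscale (\<alpha> / 2 - \<beta>) (e 2)"
  "nabla (e 2) (e 1) = rscale (- \<gamma>) (e 2) + rscale (\<alpha> / 2) (e 3)"
  "nabla (e 2) (e 2) = rscale \<gamma> (e 1)"
  "nabla (e 2) (e 3) = rscale (\<alpha> / 2) (e 1)"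
  "nabla (e 3) (e 1) = rscale (\<alpha> / 2) (e 2) + rscale \<gamma> (e 3)"
  "nabla (e 3) (e 2) = rscale (- \<alpha> / 2) (e 1)"
  "nabla (e 3) (e 3) = rscale \<gamma> (e 1)"
proof -
  have mem: "nabla (e i) (e j) \<in> vector_fields A" for i j
    by (simp add: affine_connectionD(1)[OF levi_civitaD(1)[OF levi_civita]])
  have G: "inner_fun g (nabla (e i) (e j)) (e k) p =
     (inner_fun g (bracket (e i) (e j)) (e k) p - inner_fun g (bracket (e j) (e k)) (e i) p
     + inner_fun g (bracket (e k) (e i)) (e j) p) / 2" for i j k p
    using koszul_frame[of i j k p] by simp
  note simps = G bracket_frame inner_combination rscale_simps
  show "nabla (e 1) (e 1) = 0"
    using vf_expand_const[OF mem, of 1 1 0 0 0] by (simp add: simps)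
  show "nabla (e 1) (e 2) = rscale (\<alpha> / 2 - \<beta>) (e 3)"
    using vf_expand_const[OF mem, of 1 2 0 0 "\<beta> - \<alpha> / 2"] by (simp add: simps diff_divide_distrib)
  show "nabla (e 1) (e 3) = rscale (\<alpha> / 2 - \<beta>) (e 2)"
    using vf_expand_const[OF mem, of 1 3 0 "\<alpha> / 2 - \<beta>" 0] by (simp add: simps field_simps)
  show "nabla (e 2) (e 1) = rscale (- \<gamma>) (e 2) + rscale (\<alpha> / 2) (e 3)"
    using vf_expand_const[OF mem, of 2 1 0 "- \<gamma>" "- \<alpha> / 2"] by (simp add: simps field_simps)
  show "nabla (e 2) (e 2) = rscale \<gamma> (e 1)"
    using vf_expand_const[OF mem, of 2 2 \<gamma> 0 0] by (simp add: simps field_simps)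
  show "nabla (e 2) (e 3) = rscale (\<alpha> / 2) (e 1)"
    using vf_expand_const[OF mem, of 2 3 "\<alpha> / 2" 0 0] by (simp add: simps field_simps)
  show "nabla (e 3) (e 1) = rscale (\<alpha> / 2) (e 2) + rscale \<gamma> (e 3)"
    using vf_expand_const[OF mem, of 3 1 0 "\<alpha> / 2" "- \<gamma>"] by (simp add: simps field_simps)
  show "nabla (e 3) (e 2) = rscale (- \<alpha> / 2) (e 1)"
    using vf_expand_const[OF mem, of 3 2 "- \<alpha> / 2" 0 0] by (simp add: simps field_simps)
  show "nabla (e 3) (e 3) = rscale \<gamma> (e 1)"
    using vf_expand_const[OF mem, of 3 3 \<gamma> 0 0] by (simp add: simps field_simps)
qed

lemma D0_affine: "affine_connection A D0"
  by (rule canonical_connection_affine[OF levi_civitaD(1)[OF levi_civita] product_structure])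

text \<open>Conjugation by J reverses the components that cross between the two eigenspaces of J, so
  averaging deletes them from the table of \<open>nabla\<close>. No \<nabla>_X e3 has an
  e3-component, hence nothing of it survives.\<close>

lemma D0_frame:
  "D0 (e 1) (e k) = 0"
  "D0 (e 2) (e 1) = rscale (- \<gamma>) (e 2)"
  "D0 (e 2) (e 2) = rscale \<gamma> (e 1)"
  "D0 (e 3) (e 1) = rscale (\<alpha> / 2) (e 2)"
  "D0 (e 3) (e 2) = rscale (- \<alpha> / 2) (e 1)"
  "D0 (e k) (e 3) = 0"
proof -
  have J: "tensor_1_1 A J"
    using product_structure by (simp add: left_invariant_product_structure_def)
  note lc = levi_civitaD(1)[OF levi_civita]
  note simps = canonical_connection_eq[OF lc product_structure] tensor_1_1_linear[OF J]
    affine_connection_linear[OF lc] nabla_frame rscale_simps tensor_1_1_linear(6)[OF J frame_vf]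
  have "D0 (e 1) (e 1) = 0" "D0 (e 1) (e 2) = 0" "D0 (e 1) (e 3) = 0" "D0 (e 2) (e 3) = 0"
    "D0 (e 3) (e 3) = 0" "D0 (e 2) (e 1) = rscale (- \<gamma>) (e 2)"
    "D0 (e 2) (e 2) = rscale \<gamma> (e 1)" "D0 (e 3) (e 1) = rscale (\<alpha> / 2) (e 2)"
    "D0 (e 3) (e 2) = rscale (- \<alpha> / 2) (e 1)"
    by (simp_all add: simps) (simp_all add: vfield_ops field_simps)
  then show "D0 (e 1) (e k) = 0" "D0 (e k) (e 3) = 0"
    "D0 (e 2) (e 1) = rscale (- \<gamma>) (e 2)" "D0 (e 2) (e 2) = rscale \<gamma> (e 1)"
    "D0 (e 3) (e 1) = rscale (\<alpha> / 2) (e 2)" "D0 (e 3) (e 2) = rscale (- \<alpha> / 2) (e 1)"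
    using exhaust_3[of k] by auto
qed

text \<open>The connection is D0_X e1 = w(X) e2, D0_X e2 = - w(X) e1 with w(e1) = 0, w(e2) = -
  \<gamma>, w(e3) = \<alpha>/2. Rotations of a plane commute, so on the frame only the bracket term
  of the curvature is left: R(X,Y) e1 = - w([X,Y]) e2 and R(X,Y) e2 = w([X,Y]) e1. The form is not
  symmetric in general: the (3,2) entry has no (2,3) counterpart.\<close>

lemma ricci_frame:
  "ricci g e D0 (e 1) (e 1) = (\<lambda>_. - (\<alpha> * \<beta> / 2 + \<gamma>\<^sup>2))"
  "ricci g e D0 (e 2) (e 2) = (\<lambda>_. - (\<alpha> * \<beta> / 2 + \<gamma>\<^sup>2))"
  "ricci g e D0 (e 3) (e 2) = (\<lambda>_. \<gamma> * (\<beta> - \<alpha> / 2))"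
  "ricci g e D0 (e 1) (e 2) = (\<lambda>_. 0)"
  "ricci g e D0 (e 2) (e 1) = (\<lambda>_. 0)"
  "ricci g e D0 (e 3) (e 1) = (\<lambda>_. 0)"
  "ricci g e D0 (e k) (e 3) = (\<lambda>_. 0)"
proof -
  have z: "0 \<in> vector_fields A" using vf_zero[OF frame_vf] .
  note simps = ricci_def curvature_def bracket_frame D0_frame affine_connectionD[OF D0_affine]
    affine_connection_linear[OF D0_affine] inner_fun_linear(1,3,4,5)
    inner_fun_linear(6)[OF frame_vf frame_vf] rscale_simps z affine_connection_linear(5,6)[OF D0_affine frame_vf frame_vf]
  show "ricci g e D0 (e 1) (e 1) = (\<lambda>_. - (\<alpha> * \<beta> / 2 + \<gamma>\<^sup>2))"
    "ricci g e D0 (e 2) (e 2) = (\<lambda>_. - (\<alpha> * \<beta> / 2 + \<gamma>\<^sup>2))"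
    "ricci g e D0 (e 3) (e 2) = (\<lambda>_. \<gamma> * (\<beta> - \<alpha> / 2))"
    "ricci g e D0 (e 1) (e 2) = (\<lambda>_. 0)"
    "ricci g e D0 (e 2) (e 1) = (\<lambda>_. 0)"
    "ricci g e D0 (e 3) (e 1) = (\<lambda>_. 0)"
    by (simp_all add: simps) (simp_all add: fun_eq_iff algebra_simps power2_eq_square)
  have "ricci g e D0 (e 1) (e 3) = (\<lambda>_. 0)" "ricci g e D0 (e 2) (e 3) = (\<lambda>_. 0)"
    "ricci g e D0 (e 3) (e 3) = (\<lambda>_. 0)"
    by (simp_all add: simps) (simp_all add: fun_eq_iff)
  then show "ricci g e D0 (e k) (e 3) = (\<lambda>_. 0)"
    using exhaust_3[of k] by auto
qed

abbreviation T0 :: "'m vfield \<Rightarrow> 'm vfield \<Rightarrow> 'm \<Rightarrow> real" where "T0 \<equiv> ricci_sym g e D0"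

lemma T0_tensor: "tensor_0_2 A T0"
  by (rule ricci_sym_tensor[OF D0_affine frame_vf])

lemma T0_frame:
  "T0 (e 1) (e 1) = (\<lambda>_. - (\<alpha> * \<beta> / 2 + \<gamma>\<^sup>2))"
  "T0 (e 2) (e 2) = (\<lambda>_. - (\<alpha> * \<beta> / 2 + \<gamma>\<^sup>2))"
  "T0 (e 2) (e 3) = (\<lambda>_. \<gamma> * (\<beta> - \<alpha> / 2) / 2)"
  "T0 (e 3) (e 2) = (\<lambda>_. \<gamma> * (\<beta> - \<alpha> / 2) / 2)"
  "T0 (e 3) (e 3) = (\<lambda>_. 0)"
  "T0 (e 1) (e 2) = (\<lambda>_. 0)" "T0 (e 2) (e 1) = (\<lambda>_. 0)"
  "T0 (e 1) (e 3) = (\<lambda>_. 0)" "T0 (e 3) (e 1) = (\<lambda>_. 0)"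
  by (simp_all add: ricci_sym_def ricci_frame) (simp_all add: fun_eq_iff field_simps)

text \<open>With r = - (\<alpha>\<beta>/2 + \<gamma>^2) and s = \<gamma>(\<beta> - \<alpha>/2)/2 the
  coefficients are A = 2(\<beta>s - \<gamma>r), B = 2((\<beta> - \<alpha>)r + \<gamma>s), C =
  2(\<gamma>s - \<alpha>r), D = - 2\<beta>s. The derivative along \<xi> contributes nothing, as the
  form is constant on the frame, and symmetry leaves six components.\<close>

lemma lie_derivative_T0_frame:
  assumes "\<xi> = rscale l1 (e 1) + rscale l2 (e 2) + rscale l3 (e 3)"
  shows "(\<forall>j k. lie_derivative \<xi> T0 (e j) (e k) = 0) \<longleftrightarrow>
    (2 * \<gamma>\<^sup>2 + \<beta>\<^sup>2 + 1/2 * \<alpha> * \<beta>) * \<gamma> * l1 = 0 \<and> (\<alpha> * \<beta> / 2 + \<gamma>\<^sup>2) * \<beta> * l1 = 0 \<and>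
    \<beta> * \<gamma> * (1/2 * \<alpha> - \<beta>) * l1 = 0 \<and>
    \<gamma> * (2 * \<gamma>\<^sup>2 + \<beta>\<^sup>2 + 1/2 * \<alpha> * \<beta>) * l2
      + (\<gamma>\<^sup>2 * (3/2 * \<alpha> - \<beta>) + \<alpha> * \<beta> * (\<alpha> - \<beta>)) * l3 = 0 \<and>
    (\<gamma>\<^sup>2 * (\<beta> + 3/2 * \<alpha>) + \<alpha>\<^sup>2 * \<beta>) * l2 + \<beta> * \<gamma> * (1/2 * \<alpha> - \<beta>) * l3 = 0"
    (is "?L \<longleftrightarrow> ?a * l1 = 0 \<and> ?b * l1 = 0 \<and> ?D * l1 = 0 \<and> ?A * l2 + ?B * l3 = 0 \<and> ?C * l2 + ?D * l3 = 0")
proof -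
  let ?L = "lie_derivative \<xi> T0"
  have \<xi>: "\<xi> \<in> vector_fields A"
    by (simp add: assms)
  have sym: "?L X Y = ?L Y X" for X Y
    by (simp add: lie_derivative_def ricci_sym_def app_def fun_eq_iff add.commute)
  have br: "bracket \<xi> (e 1) = rscale (\<beta> * l3 - \<gamma> * l2) (e 2) + rscale (\<beta> * l2 + \<gamma> * l3) (e 3)"
    "bracket \<xi> (e 2) = rscale (- \<alpha> * l3) (e 1) + rscale (\<gamma> * l1) (e 2) + rscale (- \<beta> * l1) (e 3)"
    "bracket \<xi> (e 3) = rscale (\<alpha> * l2) (e 1) + rscale (- \<beta> * l1) (e 2) + rscale (- \<gamma> * l1) (e 3)"
    by (simp_all add: assms bracket_add_left bracket_rscale_left bracket_frame rscale_simps)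
      (simp_all add: vfield_ops algebra_simps)
  note simps = lie_derivative_def app_const[OF \<xi>] br tensor_0_2D(2,3)[OF T0_tensor] tensor_rscale[OF T0_tensor]
    T0_frame
  have L: "?L (e 1) (e 1) p = 0"
    "?L (e 1) (e 2) p = - (?A * l2 + ?B * l3) / 2"
    "?L (e 1) (e 3) p = (?C * l2 + ?D * l3) / 2"
    "?L (e 2) (e 2) p = ?a * l1"
    "?L (e 2) (e 3) p = - (?b * l1)"
    "?L (e 3) (e 3) p = - (?D * l1)" for p
    by (simp_all add: simps) (simp_all add: field_simps power2_eq_square)
  have "(\<forall>j k. ?L (e j) (e k) = 0) \<longleftrightarrow> (\<forall>p. ?L (e 1) (e 1) p = 0 \<and> ?L (e 1) (e 2) p = 0 \<and>
      ?L (e 1) (e 3) p = 0 \<and> ?L (e 2) (e 2) p = 0 \<and> ?L (e 2) (e 3) p = 0 \<and> ?L (e 3) (e 3) p = 0)"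
    unfolding forall_3 sym[of "e 2" "e 1"] sym[of "e 3" "e 1"] sym[of "e 3" "e 2"]
      fun_eq_iff[of "?L X Y" for X Y] zero_fun_apply
    by blast
  also have "\<dots> \<longleftrightarrow> ?a * l1 = 0 \<and> ?b * l1 = 0 \<and> ?D * l1 = 0 \<and> ?A * l2 + ?B * l3 = 0 \<and> ?C * l2 + ?D * l3 = 0"
    unfolding L by auto
  finally show ?thesis .
qed


section \<open>Collineations in coordinates along the frame\<close>

definition frame_comb :: "real \<Rightarrow> real \<Rightarrow> real \<Rightarrow> 'm vfield" where
  "frame_comb l1 l2 l3 = rscale l1 (e 1) + rscale l2 (e 2) + rscale l3 (e 3)"

lemma ricci_collineations_eq:
  assumes "lie_basis m A e" and \<gamma>: "\<gamma> \<noteq> 0"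
  shows "ricci_collineations m A g e D0 =
    {frame_comb 0 l2 l3 |l2 l3.
      \<gamma> * (2 * \<gamma>^2 + \<beta>^2 + 1/2 * \<alpha> * \<beta>) * l2
        + (\<gamma>^2 * (3/2 * \<alpha> - \<beta>) + \<alpha> * \<beta> * (\<alpha> - \<beta>)) * l3 = 0 \<and>
      (\<gamma>^2 * (\<beta> + 3/2 * \<alpha>) + \<alpha>^2 * \<beta>) * l2 + \<beta> * \<gamma> * (1/2 * \<alpha> - \<beta>) * l3 = 0}"
    (is "_ = {frame_comb 0 l2 l3 |l2 l3. ?P l2 l3}")
proof -
  have la: "\<xi> \<in> lie_algebra m A \<longleftrightarrow> (\<exists>l1 l2 l3. \<xi> = frame_comb l1 l2 l3)" for \<xi>
  proof -
    have "lie_algebra m A = range (\<lambda>c::real^3. frame_comb (c $ 1) (c $ 2) (c $ 3))"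
      using assms(1) by (simp add: lie_basis_def bij_betw_def sum_3 frame_comb_def)
    moreover have "frame_comb l1 l2 l3 \<in> range (\<lambda>c::real^3. frame_comb (c $ 1) (c $ 2) (c $ 3))"
      for l1 l2 l3
      by (rule range_eqI[of _ _ "vector [l1, l2, l3]"]) simp
    ultimately show ?thesis by blast
  qed
  have coll: "(\<forall>X\<in>vector_fields A. \<forall>Y\<in>vector_fields A.
      lie_derivative (frame_comb l1 l2 l3) T0 X Y = 0) \<longleftrightarrow> l1 = 0 \<and> ?P l2 l3" for l1 l2 l3
  proof -
    have comb_vf: "frame_comb l1 l2 l3 \<in> vector_fields A"
      by (simp add: frame_comb_def)
    \<comment> \<open>If \<beta> = 0, the first equation reads 2\<gamma>^2 = 0 after division by
      \<gamma> l1. Otherwise \<alpha>\<beta>/2 + \<gamma>^2 = 0, and subtracting this leaves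
      \<gamma>^2 + \<beta>^2 = 0.\<close>
    have "l1 = 0" if "(2 * \<gamma>^2 + \<beta>^2 + 1/2 * \<alpha> * \<beta>) * \<gamma> * l1 = 0" "(\<alpha> * \<beta> / 2 + \<gamma>^2) * \<beta> * l1 = 0"
    proof (rule ccontr)
      assume "l1 \<noteq> 0"
      with that \<gamma> have 1: "2 * \<gamma>^2 + \<beta>^2 + \<alpha> * \<beta> / 2 = 0" and 2: "\<beta> = 0 \<or> \<alpha> * \<beta> / 2 + \<gamma>^2 = 0"
        by auto
      have "\<gamma>^2 > 0" "\<beta>^2 \<ge> 0"
        using \<gamma> by simp_all
      with 1 2 show False by auto
    qed
    then show ?thesis
      unfolding tensor_eq_0_iff_frame[OF lie_derivative_tensor[OF T0_tensor comb_vf]]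
        lie_derivative_T0_frame[OF frame_comb_def]
      by auto
  qed
  have "ricci_collineations m A g e D0 = {frame_comb l1 l2 l3 |l1 l2 l3. \<forall>X\<in>vector_fields A.
      \<forall>Y\<in>vector_fields A. lie_derivative (frame_comb l1 l2 l3) T0 X Y = 0}"
  proof -
    have "{\<xi> \<in> lie_algebra m A. Q \<xi>} = {frame_comb l1 l2 l3 |l1 l2 l3. Q (frame_comb l1 l2 l3)}" for Q
      using la by fastforce
    then show ?thesis
      by (simp only: ricci_collineations_def)
  qed
  then show ?thesis
    unfolding coll by blast
qed

lemma frame_comb_eq_0_iff:
  assumes "lie_basis m A e"
  shows "frame_comb l1 l2 l3 = 0 \<longleftrightarrow> l1 = 0 \<and> l2 = 0 \<and> l3 = 0"
proof
  assume *: "frame_comb l1 l2 l3 = 0"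
  have "inj (\<lambda>c::real^3. frame_comb (c $ 1) (c $ 2) (c $ 3))"
    using assms(1) by (simp add: lie_basis_def bij_betw_def sum_3 frame_comb_def)
  from injD[OF this, of "vector [l1, l2, l3]" 0] *
  have "(vector [l1, l2, l3] :: real^3) = 0"
    by (simp add: frame_comb_def rscale_simps)
  then show "l1 = 0 \<and> l2 = 0 \<and> l3 = 0"
    by (simp add: vec_eq_iff forall_3)
qed (simp add: frame_comb_def rscale_simps)

end

section \<open>Solving the linear system\<close>

lemma real_span_singleton: "real_span {X} = range (\<lambda>c. rscale c X)"
proof -
  interpret module "rscale :: real \<Rightarrow> 'm vfield \<Rightarrow> 'm vfield"
    by unfold_locales (simp_all add: vfield_ops algebra_simps)
  show ?thesis
    unfolding real_span_def by (rule span_singleton)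
qed

text \<open>The first two claims exclude nonzero solutions when exactly one of \<alpha>, \<beta> is
  zero; the third makes the quotient C/D legitimate. For \<beta> = 0 one has D = 0 and B = C = 3/2
  \<alpha>\<gamma>^2.\<close>

lemma coefficient_determinant:
  fixes \<alpha> \<beta> \<gamma> :: real
  defines "A \<equiv> \<gamma> * (2 * \<gamma>^2 + \<beta>^2 + 1/2 * \<alpha> * \<beta>)"
    and "B \<equiv> \<gamma>^2 * (3/2 * \<alpha> - \<beta>) + \<alpha> * \<beta> * (\<alpha> - \<beta>)"
    and "C \<equiv> \<gamma>^2 * (\<beta> + 3/2 * \<alpha>) + \<alpha>^2 * \<beta>"
    and "D \<equiv> \<beta> * \<gamma> * (1/2 * \<alpha> - \<beta>)"
  assumes "\<gamma> \<noteq> 0"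
  shows "\<alpha> = 0 \<Longrightarrow> \<beta> \<noteq> 0 \<Longrightarrow> A * D - B * C \<noteq> 0"
    and "\<alpha> \<noteq> 0 \<Longrightarrow> \<beta> = 0 \<Longrightarrow> A * D - B * C \<noteq> 0"
    and "\<alpha> \<noteq> 0 \<Longrightarrow> \<beta> \<noteq> 0 \<Longrightarrow> A * D - B * C = 0 \<Longrightarrow> D \<noteq> 0"
proof -
  have pos: "\<gamma>^2 + \<beta>^2 > 0"
    using \<open>\<gamma> \<noteq> 0\<close> by (simp add: add_pos_nonneg)
  show "A * D - B * C \<noteq> 0" if "\<alpha> = 0" "\<beta> \<noteq> 0"
  proof -
    have "A * D - B * C = - (\<beta>^2 * \<gamma>^2 * (\<gamma>^2 + \<beta>^2))"
      using that(1) by (simp add: assms(1-4) algebra_simps power2_eq_square)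
    then show ?thesis using that \<open>\<gamma> \<noteq> 0\<close> pos by simp
  qed
  show "A * D - B * C \<noteq> 0" if "\<alpha> \<noteq> 0" "\<beta> = 0"
    using that \<open>\<gamma> \<noteq> 0\<close> by (simp add: assms(1-4))
  show "D \<noteq> 0" if "\<alpha> \<noteq> 0" "\<beta> \<noteq> 0" "A * D - B * C = 0"
  proof
    assume "D = 0"
    then have \<alpha>: "\<alpha> = 2 * \<beta>"
      using that(2) \<open>\<gamma> \<noteq> 0\<close> by (simp add: assms(4))
    \<comment> \<open>With D = 0 the determinant is - B C, and at \<alpha> = 2\<beta> both factors
      are nonzero multiples of \<beta>(\<gamma>^2 + \<beta>^2).\<close>
    have "B * C = 2 * \<beta> * (\<gamma>^2 + \<beta>^2) * (4 * \<beta> * (\<gamma>^2 + \<beta>^2))"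
      by (simp add: assms(2,3) \<alpha> algebra_simps power2_eq_square)
    with that(2,3) \<open>D = 0\<close> pos show False by simp
  qed
qed

theorem theorem3p11:
  fixes m :: "'g::{t2_space,second_countable_topology} \<Rightarrow> 'g \<Rightarrow> 'g"
    and u :: 'g and i :: "'g \<Rightarrow> 'g"
    and Atl :: "('g, real^3) atlas"
    and g :: "'g metric" and J :: "'g endo_field" and nabla :: "'g connection"
    and e :: "3 \<Rightarrow> 'g vfield"
    and \<alpha> \<beta> \<gamma> :: real
  defines "A \<equiv> \<gamma> * (2 * \<gamma>^2 + \<beta>^2 + 1/2 * \<alpha> * \<beta>)"
    and "B \<equiv> \<gamma>^2 * (3/2 * \<alpha> - \<beta>) + \<alpha> * \<beta> * (\<alpha> - \<beta>)"
    and "C \<equiv> \<gamma>^2 * (\<beta> + 3/2 * \<alpha>) + \<alpha>^2 * \<beta>"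
    and "D \<equiv> \<beta> * \<gamma> * (1/2 * \<alpha> - \<beta>)"
    and "V \<equiv> ricci_collineations m Atl g e (canonical_connection nabla J)"
  assumes "\<gamma> \<noteq> 0"
    and "lie_group m u i Atl" and "connected (UNIV :: 'g set)" and "unimodular m Atl"
    and "lorentzian_metric Atl g" and "left_invariant_metric m Atl g"
    and "lie_basis m Atl e"
    and "\<forall>p. pseudo_orthonormal (g p) (\<lambda>k. e k p)"
    and "bracket (e 1) (e 2) = rscale \<gamma> (e 2) - rscale \<beta> (e 3)"
    and "bracket (e 1) (e 3) = - rscale \<beta> (e 2) - rscale \<gamma> (e 3)"
    and "bracket (e 2) (e 3) = rscale \<alpha> (e 1)"
    and "left_invariant_product_structure m Atl J"
    and "endo_app J (e 1) = e 1" and "endo_app J (e 2) = e 2" and "endo_app J (e 3) = - e 3"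
    and "levi_civita Atl g nabla"
  shows "((\<exists>\<xi>\<in>V. \<xi> \<noteq> 0) \<longleftrightarrow>
            \<alpha> = 0 \<and> \<beta> = 0 \<or>
            \<alpha> \<noteq> 0 \<and> \<beta> \<noteq> 0 \<and> det (vector [vector [A, B], vector [C, D]] :: real^2^2) = 0) \<and>
         (\<alpha> = 0 \<and> \<beta> = 0 \<longrightarrow> V = real_span {e 3}) \<and>
         (\<alpha> \<noteq> 0 \<and> \<beta> \<noteq> 0 \<and> det (vector [vector [A, B], vector [C, D]] :: real^2^2) = 0 \<longrightarrow>
            V = real_span {e 2 - rscale (C / D) (e 3)})"
proof -
  have "smooth_atlas Atl"
    using \<open>lie_group m u i Atl\<close> by (simp add: lie_group_def)
  then interpret lorentzian_manifold Atl g nabla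
    using \<open>lorentzian_metric Atl g\<close> \<open>levi_civita Atl g nabla\<close> by unfold_locales
  have "e k \<in> lie_algebra m Atl" for k
  proof -
    have *: "(\<Sum>j\<in>UNIV. rscale (axis k 1 $ j) (e j)) = e k"
      using exhaust_3[of k] by (auto simp: sum_3 axis_def rscale_simps)
    show ?thesis
      using bij_betw_apply[OF \<open>lie_basis m Atl e\<close>[unfolded lie_basis_def] UNIV_I, of "axis k 1"]
      unfolding * .
  qed
  then have "e k \<in> vector_fields Atl" for k
    by (simp add: lie_algebra_def)
  then interpret group_G2_frame Atl g nabla e m J \<alpha> \<beta> \<gamma>
    using assms by unfold_locales auto
  let ?det = "det (vector [vector [A, B], vector [C, D]] :: real^2^2)"
  have det: "?det = A * D - B * C"
    by (simp add: det_2)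
  note coeff = coefficient_determinant[OF \<open>\<gamma> \<noteq> 0\<close>, of \<alpha> \<beta>, folded A_def B_def C_def D_def]
  note V = ricci_collineations_eq[OF \<open>lie_basis m Atl e\<close> \<open>\<gamma> \<noteq> 0\<close>,
      folded V_def A_def B_def C_def D_def]
  note comb_0 = frame_comb_eq_0_iff[OF \<open>lie_basis m Atl e\<close>]
  \<comment> \<open>Here A = 2\<gamma>^3 and B = C = D = 0, so the system only says l2 = 0 and l3 is
    free.\<close>
  have case1: "V = real_span {e 3}" if "\<alpha> = 0 \<and> \<beta> = 0"
    using that \<open>\<gamma> \<noteq> 0\<close>
    by (auto simp: V real_span_singleton frame_comb_def rscale_simps A_def B_def C_def D_def)
  have case2: "V = real_span {e 2 - rscale (C / D) (e 3)}"
    if c: "\<alpha> \<noteq> 0 \<and> \<beta> \<noteq> 0 \<and> ?det = 0"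
  proof -
    have D: "D \<noteq> 0"
      using coeff(3) c det by simp
    have "A * l2 + B * l3 = 0 \<and> C * l2 + D * l3 = 0 \<longleftrightarrow> l3 = - (l2 * (C / D))" for l2 l3
    proof
      assume "A * l2 + B * l3 = 0 \<and> C * l2 + D * l3 = 0"
      then show "l3 = - (l2 * (C / D))"
        using D by (simp add: field_simps)
    next
      assume l3: "l3 = - (l2 * (C / D))"
      \<comment> \<open>The second equation fixes l3; the vanishing determinant makes the first one
        a consequence of it, after multiplication by D \<noteq> 0.\<close>
      then have "D * (A * l2 + B * l3) = (A * D - B * C) * l2"
        using D by (simp add: algebra_simps)
      then have "A * l2 + B * l3 = 0"
        using c det D by simp
      with l3 D show "A * l2 + B * l3 = 0 \<and> C * l2 + D * l3 = 0"
        by simp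
    qed
    then have "V = {frame_comb 0 l2 (- (l2 * (C / D))) |l2. True}"
      unfolding V by auto
    moreover have "frame_comb 0 l2 (- (l2 * (C / D))) = rscale l2 (e 2 - rscale (C / D) (e 3))" for l2
      by (simp add: frame_comb_def vfield_ops algebra_simps)
    ultimately show ?thesis
      by (auto simp: real_span_singleton)
  qed
  have "(\<exists>\<xi>\<in>V. \<xi> \<noteq> 0) \<longleftrightarrow> \<alpha> = 0 \<and> \<beta> = 0 \<or> \<alpha> \<noteq> 0 \<and> \<beta> \<noteq> 0 \<and> ?det = 0"
  proof
    assume "\<exists>\<xi>\<in>V. \<xi> \<noteq> 0"
    then obtain l2 l3 where l: "A * l2 + B * l3 = 0" "C * l2 + D * l3 = 0" "l2 \<noteq> 0 \<or> l3 \<noteq> 0"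
      unfolding V using comb_0 by auto
    \<comment> \<open>Cramer's rule: the determinant annihilates both coordinates, one of which is
      nonzero.\<close>
    have "(A * D - B * C) * l2 = D * (A * l2 + B * l3) - B * (C * l2 + D * l3)"
      "(A * D - B * C) * l3 = A * (C * l2 + D * l3) - C * (A * l2 + B * l3)"
      by (simp_all add: algebra_simps)
    then have "A * D - B * C = 0"
      using l by auto
    then show "\<alpha> = 0 \<and> \<beta> = 0 \<or> \<alpha> \<noteq> 0 \<and> \<beta> \<noteq> 0 \<and> ?det = 0"
      using coeff(1,2) det by auto
  next
    have "e 3 = frame_comb 0 0 1" "e 2 - rscale (C / D) (e 3) = frame_comb 0 1 (- (C / D))"
      by (simp_all add: frame_comb_def rscale_simps)
    then have "e 3 \<noteq> 0" "e 2 - rscale (C / D) (e 3) \<noteq> 0"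
      by (simp_all add: comb_0)
    moreover have "X \<in> real_span {X}" for X :: "'g vfield"
      using rscale_simps(8)[of X] unfolding real_span_singleton by (metis rangeI)
    moreover assume "\<alpha> = 0 \<and> \<beta> = 0 \<or> \<alpha> \<noteq> 0 \<and> \<beta> \<noteq> 0 \<and> ?det = 0"
    ultimately show "\<exists>\<xi>\<in>V. \<xi> \<noteq> 0"
      using case1 case2 by metis
  qed
  with case1 case2 show ?thesis by blast
qed

end
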